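(* Let $p,m,q\ge0$, $n=p+m+q$, $G=GL_n(\mathbb C)$, $B\subset G$ the subgroup of upper triangular matrices, and $S\subset G$ the subgroup of invertible block matrices $\begin{bmatrix}GL_p&0&0\\ *&GL_m&*\\ 0&0&GL_q\end{bmatrix}$ (blocks of sizes $p,m,q$). Then the $S$-orbits of $G/B$ are finite in number and parametrized by $(p,m,q)$-preclans: $$G/B=\bigsqcup_{\gamma}S\dot\gamma B/B,$$ the disjoint union being over all $(p,m,q)$-preclans $\gamma$.
   Context: A $(p,m,q)$-preclan is a partial matching on nodes $1,\dots,n$ (disjoint pairs $(i,j)$, $i<j$; left-end $i$, right-end $j$), each unmatched node being colored $+$, colored $-$, or uncolored, with (number of $+$'s)+(number of matchings)$=p$, (number of $-$'s)+(number of matchings)$=q$, and $m$ uncolored (unmatched) nodes. The permutation $\sigma_\gamma\in S_n$: assign $1,\dots,p$ to the $+$'s and left-ends from left to right, then $p+1,\dots,p+m$ to the uncolored nodes from left to right, then $p+m+1,\dots,n$ to the $-$'s and right-ends from left to right; $\sigma_\gamma(i)$ is the label of node $i$. The matrix $\dot\gamma=[\dot\gamma_1\ \cdots\ \dot\gamma_n]\in GL_n$ has columns $\dot\gamma_i=\mathbf e_{\sigma_\gamma(i)}+\mathbf e_{\sigma_\gamma(j)}$ if $i$ is the left-end of a matching $(i,j)$, and $\dot\gamma_i=\mathbf e_{\sigma_\gamma(i)}$ otherwise, where $\mathbf e_1,\dots,\mathbf e_n$ is the standard basis. *)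

theory Defs
  imports
    "Jordan_Normal_Form.Matrix"
    "HOL-Algebra.Left_Coset"
    "HOL-Algebra.Group_Action"
    "HOL-Library.Disjoint_Sets"
    Complex_Main
begin

text \<open>Nodes are numbered from 1 to \<open>n\<close>. The matching is a set of pairs (left-end, right-end);
  the uncolored nodes are the unmatched nodes that are neither plus nor minus nodes.\<close>

record preclan =
  matching :: "(nat \<times> nat) set"
  plus_nodes :: "nat set"
  minus_nodes :: "nat set"

definition left_ends :: "preclan \<Rightarrow> nat set" where
  "left_ends \<gamma> = fst ` matching \<gamma>"

definition right_ends :: "preclan \<Rightarrow> nat set" where
  "right_ends \<gamma> = snd ` matching \<gamma>"

definition partial_matching :: "nat \<Rightarrow> (nat \<times> nat) set \<Rightarrow> bool" where
  "partial_matching n M \<longleftrightarrow>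
     (\<forall>(i, j) \<in> M. 1 \<le> i \<and> i < j \<and> j \<le> n) \<and>
     (\<forall>(i, j) \<in> M. \<forall>(k, l) \<in> M. (i, j) \<noteq> (k, l) \<longrightarrow> {i, j} \<inter> {k, l} = {})"

definition unmatched_nodes :: "nat \<Rightarrow> preclan \<Rightarrow> nat set" where
  "unmatched_nodes n \<gamma> = {1..n} - (left_ends \<gamma> \<union> right_ends \<gamma>)"

definition uncolored_nodes :: "nat \<Rightarrow> preclan \<Rightarrow> nat set" where
  "uncolored_nodes n \<gamma> = unmatched_nodes n \<gamma> - (plus_nodes \<gamma> \<union> minus_nodes \<gamma>)"

definition preclans :: "nat \<Rightarrow> nat \<Rightarrow> nat \<Rightarrow> preclan set" where
  "preclans p m q = {\<gamma>. let n = p + m + q in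
     partial_matching n (matching \<gamma>) \<and>
     plus_nodes \<gamma> \<subseteq> unmatched_nodes n \<gamma> \<and>
     minus_nodes \<gamma> \<subseteq> unmatched_nodes n \<gamma> \<and>
     plus_nodes \<gamma> \<inter> minus_nodes \<gamma> = {} \<and>
     card (plus_nodes \<gamma>) + card (matching \<gamma>) = p \<and>
     card (minus_nodes \<gamma>) + card (matching \<gamma>) = q \<and>
     card (uncolored_nodes n \<gamma>) = m}"

text \<open>Position of \<open>i\<close>, counted from 1, when the nodes in \<open>A\<close> are listed from left to right.\<close>

definition rank_in :: "nat set \<Rightarrow> nat \<Rightarrow> nat" where
  "rank_in A i = card {k \<in> A. k \<le> i}"

definition preclan_perm :: "nat \<Rightarrow> nat \<Rightarrow> nat \<Rightarrow> preclan \<Rightarrow> nat \<Rightarrow> nat" where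
  "preclan_perm p m q \<gamma> i =
     (if i \<in> plus_nodes \<gamma> \<union> left_ends \<gamma>
        then rank_in (plus_nodes \<gamma> \<union> left_ends \<gamma>) i
      else if i \<in> uncolored_nodes (p + m + q) \<gamma>
        then p + rank_in (uncolored_nodes (p + m + q) \<gamma>) i
      else p + m + rank_in (minus_nodes \<gamma> \<union> right_ends \<gamma>) i)"

text \<open>The library indexes vectors and matrices from 0, so the basis vector
  written \<open>e\<^sub>k\<close> with \<open>k \<ge> 1\<close> is \<^term>\<open>unit_vec n (k - 1)\<close>, and column \<open>i\<close> of the
  matrix is stored at index \<open>i - 1\<close>.\<close>

definition std_basis :: "nat \<Rightarrow> nat \<Rightarrow> complex vec" where
  "std_basis n k = unit_vec n (k - 1)"

definition preclan_col :: "nat \<Rightarrow> nat \<Rightarrow> nat \<Rightarrow> preclan \<Rightarrow> nat \<Rightarrow> complex vec" where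
  "preclan_col p m q \<gamma> i =
     (let n = p + m + q; \<sigma> = preclan_perm p m q \<gamma> in
      if i \<in> left_ends \<gamma>
      then std_basis n (\<sigma> i) + std_basis n (\<sigma> (THE j. (i, j) \<in> matching \<gamma>))
      else std_basis n (\<sigma> i))"

definition preclan_mat :: "nat \<Rightarrow> nat \<Rightarrow> nat \<Rightarrow> preclan \<Rightarrow> complex mat" where
  "preclan_mat p m q \<gamma> =
     mat_of_cols (p + m + q) (map (preclan_col p m q \<gamma>) [1..<Suc (p + m + q)])"

definition GL :: "nat \<Rightarrow> complex mat monoid" where
  "GL n = units_of (ring_mat TYPE(complex) n ())"

definition upper_tri_subgroup :: "nat \<Rightarrow> complex mat set" where
  "upper_tri_subgroup n = {A \<in> carrier (GL n). upper_triangular A}"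

text \<open>In \<open>block_subgroup p m q\<close> the matrix with rows of blocks
  \<open>[a, 0, 0]\<close>, \<open>[x, b, y]\<close>, \<open>[0, 0, c]\<close> is assembled by splitting off the last
  block row and the last block column.\<close>

definition block_subgroup :: "nat \<Rightarrow> nat \<Rightarrow> nat \<Rightarrow> complex mat set" where
  "block_subgroup p m q = {A \<in> carrier (GL (p + m + q)).
     \<exists>a \<in> carrier (GL p). \<exists>b \<in> carrier (GL m). \<exists>c \<in> carrier (GL q).
     \<exists>x \<in> carrier_mat m p. \<exists>y \<in> carrier_mat m q.
       A = four_block_mat
             (four_block_mat a (0\<^sub>m p m) x b)  (0\<^sub>m p q @\<^sub>r y)
             (0\<^sub>m q (p + m))                   c}"

definition flag_variety :: "nat \<Rightarrow> complex mat set set" where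
  "flag_variety n = lcosets\<^bsub>GL n\<^esub> (upper_tri_subgroup n)"

definition block_group :: "nat \<Rightarrow> nat \<Rightarrow> nat \<Rightarrow> complex mat monoid" where
  "block_group p m q = (GL (p + m + q))\<lparr>carrier := block_subgroup p m q\<rparr>"

text \<open>Left multiplication on cosets, restricted to the flag variety as the library's
  \<^locale>\<open>group_action\<close> requires.\<close>

definition left_mult :: "nat \<Rightarrow> complex mat \<Rightarrow> complex mat set \<Rightarrow> complex mat set" where
  "left_mult n s = (\<lambda>X \<in> flag_variety n. s <#\<^bsub>GL n\<^esub> X)"

definition flag_orbits :: "nat \<Rightarrow> nat \<Rightarrow> nat \<Rightarrow> complex mat set set set" where
  "flag_orbits p m q =
     orbits (block_group p m q) (flag_variety (p + m + q)) (left_mult (p + m + q))"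

definition preclan_orbit :: "nat \<Rightarrow> nat \<Rightarrow> nat \<Rightarrow> preclan \<Rightarrow> complex mat set set" where
  "preclan_orbit p m q \<gamma> =
     orbit (block_group p m q) (left_mult (p + m + q))
       (preclan_mat p m q \<gamma> <#\<^bsub>GL (p + m + q)\<^esub> upper_tri_subgroup (p + m + q))"

end

theory Submission
  imports Defs "Jordan_Normal_Form.Determinant"
begin

text \<open>
  A point of the flag variety is a coset \<open>g B\<close>, that is, the flag of the spaces \<open>F\<^sub>i\<close> spanned by the
  first \<open>i\<close> columns of \<open>g\<close>. The subgroup \<open>S\<close> is the stabilizer of two subspaces with sum the whole
  space: \<open>V\<^sub>1\<close>, spanned by the first \<open>p + m\<close> basis vectors, and \<open>V\<^sub>2\<close>, spanned by the last \<open>m + q\<close>.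
  Their intersection \<open>V\<^sub>0\<close> is spanned by the middle \<open>m\<close> basis vectors. The orbits of \<open>S\<close> are
  therefore the relative positions of a flag with respect to \<open>V\<^sub>1\<close> and \<open>V\<^sub>2\<close>, and everything reduces to
  double cosets \<open>S g B\<close>: row operations that respect \<open>V\<^sub>1\<close> and \<open>V\<^sub>2\<close>, and column operations that
  modify a column by earlier ones.

  \<^emph>\<open>Every orbit contains the matrix of a preclan.\<close> The columns are treated from left to right.
  The new column is first cleared at the rows that are already the leading row of an old column.
  If it then has a component in a free row of the first block and one in a free row of the last
  block, row operations turn it into a sum of two basis vectors: a new left-end that waits for its
  partner. If only one of these components survives, it becomes one basis vector: a plus or a minus.
  In the remaining case its part in the last block is a combination of the second rows of waiting
  left-ends. If the combination is zero, the column lies in \<open>V\<^sub>0\<close> and becomes an uncolored node;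
  otherwise the latest left-end that occurs in it is the partner of the new column, and replacing
  that left-end by the corresponding combination of left-ends (a legitimate column operation,
  because only earlier ones are added) separates the pair from all others
  (\<open>reduce_next_column\<close>). When all columns are treated, every row is the leading row of one column,
  so no left-end is still waiting. The result differs from the matrix of a preclan by a permutation
  of the rows inside the blocks (\<open>same_clan_imp_same_orbit\<close>).

  \<^emph>\<open>Different preclans give different orbits.\<close> The preclan can be read off from the flag in terms of
  \<open>V\<^sub>0\<close>, \<open>V\<^sub>1\<close>, \<open>V\<^sub>2\<close> only (\<open>flag_clan_eq_clan_of\<close>). Whether \<open>F\<^sub>i\<close> contains a vector of \<open>V\<^sub>0\<close>, of \<open>V\<^sub>1\<close> or of
  \<open>V\<^sub>2\<close> outside \<open>F\<^sub>i\<^sub>-\<^sub>1\<close> tells the kind of the node \<open>i\<close>: all three for an uncolored node, only \<open>V\<^sub>1\<close>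
  for a plus, only \<open>V\<^sub>2\<close> for a minus, \<open>V\<^sub>1\<close> and \<open>V\<^sub>2\<close> but not \<open>V\<^sub>0\<close> for a right-end, none for a
  left-end. The partner of a right-end \<open>j\<close> is the least \<open>l\<close> such that some vector of \<open>V\<^sub>2\<close> in \<open>F\<^sub>j\<close>
  outside \<open>F\<^sub>j\<^sub>-\<^sub>1\<close> is congruent modulo \<open>V\<^sub>1\<close> to a vector of \<open>F\<^sub>l\<close>.

  Below, rows and columns are indexed from 0, so column \<open>k\<close> belongs to node \<open>Suc k\<close>.
\<close>

section \<open>Matrix groups and their double cosets\<close>

lemma mult_mat_entry:
  fixes A B :: "'a :: comm_ring_1 mat"
  assumes "A \<in> carrier_mat n n" "B \<in> carrier_mat n n" "r < n" "c < n"
  shows "(A * B) $$ (r, c) = (\<Sum>k<n. A $$ (r, k) * B $$ (k, c))"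
  using assms by (auto simp: scalar_prod_def lessThan_atLeast0 intro!: sum.cong)

lemma mult_mat_vec_entry:
  fixes A :: "'a :: comm_ring_1 mat"
  assumes "A \<in> carrier_mat n n" "v \<in> carrier_vec n" "r < n"
  shows "(A *\<^sub>v v) $ r = (\<Sum>k<n. A $$ (r, k) * v $ k)"
  using assms by (auto simp: scalar_prod_def lessThan_atLeast0 intro!: sum.cong)

lemma GL_simps [simp]:
  "mult (GL n) = (*)" "one (GL n) = 1\<^sub>m n"
  by (simp_all add: GL_def units_of_def ring_mat_def)

lemma GL_iff: "A \<in> carrier (GL n) \<longleftrightarrow> A \<in> carrier_mat n n \<and> det A \<noteq> 0"
proof
  assume "A \<in> carrier (GL n)"
  then have U: "A \<in> Units (ring_mat TYPE(complex) n ())" by (simp add: GL_def units_of_def)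
  then have "A \<in> carrier_mat n n" unfolding Units_def ring_mat_simps by blast
  then show "A \<in> carrier_mat n n \<and> det A \<noteq> 0" using unit_imp_det_non_zero[OF U] by blast
next
  assume "A \<in> carrier_mat n n \<and> det A \<noteq> 0"
  then show "A \<in> carrier (GL n)"
    unfolding GL_def units_of_def using det_non_zero_imp_unit[of A n "()"] by simp
qed

lemma GL_mult: "A \<in> carrier (GL n) \<Longrightarrow> B \<in> carrier (GL n) \<Longrightarrow> A * B \<in> carrier (GL n)"
  by (auto simp: GL_iff det_mult)

lemma group_GL: "group (GL n)"
proof -
  interpret ring "ring_mat TYPE(complex) n ()" by (rule ring_mat)
  show ?thesis unfolding GL_def by (rule units_group)
qed

lemma det_block_triangular:
  fixes A :: "'a :: idom mat"
  assumes A: "A \<in> carrier_mat n n" and k: "k \<le> n"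
    and zero: "\<And>r c. r < n \<Longrightarrow> c < k \<Longrightarrow> k \<le> r \<Longrightarrow> A $$ (r, c) = 0"
  shows "det A = det (mat k k (\<lambda>(i, j). A $$ (i, j)))
           * det (mat (n - k) (n - k) (\<lambda>(i, j). A $$ (i + k, j + k)))"
proof -
  let ?A1 = "mat k k (\<lambda>(i, j). A $$ (i, j))"
  let ?A2 = "mat k (n - k) (\<lambda>(i, j). A $$ (i, j + k))"
  let ?A4 = "mat (n - k) (n - k) (\<lambda>(i, j). A $$ (i + k, j + k))"
  have "A = four_block_mat ?A1 ?A2 (0\<^sub>m (n - k) k) ?A4"
    by (rule eq_matI) (use A k zero in auto)
  then have "det A = det (four_block_mat ?A1 ?A2 (0\<^sub>m (n - k) k) ?A4)" by simp
  also have "\<dots> = det ?A1 * det ?A4"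
    by (rule det_four_block_mat_lower_left_zero) auto
  finally show ?thesis .
qed

text \<open>The zero pattern makes the lower right block of \<open>A\<close> invertible, and that block
  annihilates the lower left block of the inverse.\<close>

lemma inverse_block_upper_triangular:
  fixes A B :: "'a :: field mat"
  assumes A: "A \<in> carrier_mat n n" and B: "B \<in> carrier_mat n n" and AB: "A * B = 1\<^sub>m n"
    and k: "k \<le> n"
    and zero: "\<And>r c. r < n \<Longrightarrow> c < k \<Longrightarrow> k \<le> r \<Longrightarrow> A $$ (r, c) = 0"
    and rc: "r < n" "c < k" "k \<le> r"
  shows "B $$ (r, c) = 0"
proof -
  let ?A4 = "mat (n - k) (n - k) (\<lambda>(i, j). A $$ (i + k, j + k))"
  let ?v = "vec (n - k) (\<lambda>i. B $$ (i + k, c))"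
  have "det A * det B = 1" using det_mult[OF A B] AB by simp
  then have "det A \<noteq> 0" by auto
  then have det4: "det ?A4 \<noteq> 0"
    using det_block_triangular[OF A k zero] by auto
  have "?A4 *\<^sub>v ?v = 0\<^sub>v (n - k)"
  proof (rule eq_vecI)
    fix i assume "i < dim_vec (0\<^sub>v (n - k) :: 'a vec)"
    then have i: "i < n - k" by simp
    have "(?A4 *\<^sub>v ?v) $ i = (\<Sum>t<n - k. A $$ (i + k, t + k) * B $$ (t + k, c))"
      using i by (subst mult_mat_vec_entry[where n = "n - k"]) auto
    also have "\<dots> = (\<Sum>t\<in>{k..<n}. A $$ (i + k, t) * B $$ (t, c))"
      by (rule sum.reindex_bij_witness[of _ "\<lambda>t. t - k" "\<lambda>t. t + k"]) auto
    also have "\<dots> = (\<Sum>t<n. A $$ (i + k, t) * B $$ (t, c))"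
      by (rule sum.mono_neutral_left) (use i zero in auto)
    also have "\<dots> = (A * B) $$ (i + k, c)"
      using A B i rc by (subst mult_mat_entry) auto
    also have "\<dots> = 0" using AB i rc by auto
    finally show "(?A4 *\<^sub>v ?v) $ i = 0\<^sub>v (n - k) $ i" using i by simp
  qed simp
  then have "?v = 0\<^sub>v (n - k)"
    using det4 det_0_iff_vec_prod_zero[of ?A4 "n - k"] by (metis mat_carrier vec_carrier)
  then have "?v $ (r - k) = 0" using rc by (metis diff_less_mono index_zero_vec(1))
  then show ?thesis using rc le_add_diff_inverse2[OF rc(3)] by simp
qed

lemma inverse_block_lower_triangular:
  fixes A B :: "'a :: field mat"
  assumes A: "A \<in> carrier_mat n n" and B: "B \<in> carrier_mat n n" and AB: "A * B = 1\<^sub>m n"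
    and k: "k \<le> n"
    and zero: "\<And>r c. r < k \<Longrightarrow> c < n \<Longrightarrow> k \<le> c \<Longrightarrow> A $$ (r, c) = 0"
    and rc: "r < k" "c < n" "k \<le> c"
  shows "B $$ (r, c) = 0"
proof -
  have "B * A = 1\<^sub>m n" by (rule mat_mult_left_right_inverse[OF A B AB])
  then have "transpose_mat A * transpose_mat B = 1\<^sub>m n"
    using transpose_mult[OF B A] by simp
  then have "transpose_mat B $$ (c, r) = 0"
    using inverse_block_upper_triangular[of "transpose_mat A" n "transpose_mat B" k c r]
      A B k zero rc by simp
  then show ?thesis using B rc k by simp
qed

text \<open>The positions \<open>(t, r)\<close> at which a matrix of the block shape may be nonzero.\<close>

definition admissible :: "nat \<Rightarrow> nat \<Rightarrow> nat \<Rightarrow> nat \<Rightarrow> bool" where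
  "admissible p m t r \<longleftrightarrow> \<not> (t < p \<and> p \<le> r) \<and> \<not> (p + m \<le> t \<and> r < p + m)"

text \<open>The invertibility of the three diagonal blocks is automatic: the determinant of the
  matrix is the product of their determinants.\<close>

lemma block_subgroup_iff:
  "A \<in> block_subgroup p m q \<longleftrightarrow> A \<in> carrier (GL (p + m + q)) \<and>
     (\<forall>t<p + m + q. \<forall>r<p + m + q. \<not> admissible p m t r \<longrightarrow> A $$ (t, r) = 0)"
proof
  assume S: "A \<in> block_subgroup p m q"
  then have G: "A \<in> carrier (GL (p + m + q))" by (simp add: block_subgroup_def)
  from S obtain a b c x y where "a \<in> carrier (GL p)" "b \<in> carrier (GL m)" "c \<in> carrier (GL q)"
      and xy: "x \<in> carrier_mat m p" "y \<in> carrier_mat m q"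
      and A: "A = four_block_mat (four_block_mat a (0\<^sub>m p m) x b) (0\<^sub>m p q @\<^sub>r y) (0\<^sub>m q (p + m)) c"
    unfolding block_subgroup_def mem_Collect_eq by (elim conjE bexE) (rule that)
  then have blocks: "a \<in> carrier_mat p p" "b \<in> carrier_mat m m" "c \<in> carrier_mat q q"
    by (simp_all add: GL_iff)
  have dims: "dim_row a = p" "dim_col a = p" "dim_row b = m" "dim_col b = m" "dim_row c = q"
    "dim_col c = q" "dim_row x = m" "dim_col x = p" "dim_row y = m" "dim_col y = q"
    using blocks xy by (simp_all add: carrier_matD)
  have "A $$ (t, r) = 0" if tr: "t < p + m + q" "r < p + m + q" and na: "\<not> admissible p m t r" for t r
  proof (cases "t < p \<and> p \<le> r")
    case True
    then show ?thesis using tr unfolding A append_rows_def by (auto simp: dims)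
  next
    case False
    then have "p + m \<le> t" "r < p + m" using na by (auto simp: admissible_def)
    then show ?thesis using tr unfolding A append_rows_def by (simp add: dims)
  qed
  then show "A \<in> carrier (GL (p + m + q)) \<and>
     (\<forall>t<p + m + q. \<forall>r<p + m + q. \<not> admissible p m t r \<longrightarrow> A $$ (t, r) = 0)" using G by blast
next
  let ?n = "p + m + q"
  assume *: "A \<in> carrier (GL ?n) \<and>
     (\<forall>t<?n. \<forall>r<?n. \<not> admissible p m t r \<longrightarrow> A $$ (t, r) = 0)"
  then have A: "A \<in> carrier_mat ?n ?n" and det: "det A \<noteq> 0"
    and zero: "\<And>t r. t < ?n \<Longrightarrow> r < ?n \<Longrightarrow> \<not> admissible p m t r \<Longrightarrow> A $$ (t, r) = 0"
    by (auto simp: GL_iff)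
  let ?a = "mat p p (\<lambda>(i, j). A $$ (i, j))"
  let ?x = "mat m p (\<lambda>(i, j). A $$ (i + p, j))"
  let ?b = "mat m m (\<lambda>(i, j). A $$ (i + p, j + p))"
  let ?y = "mat m q (\<lambda>(i, j). A $$ (i + p, j + (p + m)))"
  let ?c = "mat q q (\<lambda>(i, j). A $$ (i + (p + m), j + (p + m)))"
  let ?ab = "four_block_mat ?a (0\<^sub>m p m) ?x ?b"
  have decomp: "A = four_block_mat ?ab (0\<^sub>m p q @\<^sub>r ?y) (0\<^sub>m q (p + m)) ?c"
    by (rule eq_matI) (use A zero in \<open>auto simp: append_rows_def admissible_def\<close>)
  have "det A = det ?ab * det ?c"
    by (subst decomp, rule det_four_block_mat_lower_left_zero) auto
  moreover have "det ?ab = det ?a * det ?b"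
    by (rule det_four_block_mat_upper_right_zero) auto
  ultimately have blocks: "?a \<in> carrier (GL p)" "?b \<in> carrier (GL m)" "?c \<in> carrier (GL q)"
    using det by (simp_all add: GL_iff)
  then show "A \<in> block_subgroup p m q"
    unfolding block_subgroup_def
    by (intro CollectI conjI bexI[of _ ?a] bexI[of _ ?b] bexI[of _ ?c] bexI[of _ ?x] bexI[of _ ?y])
      (rule conjunct1[OF *] decomp blocks mat_carrier)+
qed

lemma subgroup_block: "subgroup (block_subgroup p m q) (GL (p + m + q))"
proof -
  let ?n = "p + m + q"
  interpret group "GL ?n" by (rule group_GL)
  show ?thesis
  proof (rule subgroupI)
    show "block_subgroup p m q \<subseteq> carrier (GL ?n)" by (auto simp: block_subgroup_def)
    have "1\<^sub>m ?n \<in> block_subgroup p m q"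
      by (auto simp: block_subgroup_iff GL_iff admissible_def)
    then show "block_subgroup p m q \<noteq> {}" by blast
  next
    fix A assume A: "A \<in> block_subgroup p m q"
    let ?B = "inv\<^bsub>GL ?n\<^esub> A"
    have AG: "A \<in> carrier (GL ?n)" and BG: "?B \<in> carrier (GL ?n)" and AB: "A * ?B = 1\<^sub>m ?n"
      using A r_inv[of A] by (auto simp: block_subgroup_iff)
    have "?B $$ (t, r) = 0" if tr: "t < ?n" "r < ?n" and na: "\<not> admissible p m t r" for t r
    proof (cases "t < p \<and> p \<le> r")
      case True
      then show ?thesis
        using A AG BG AB tr inverse_block_lower_triangular[of A ?n ?B p t r]
        by (auto simp: block_subgroup_iff GL_iff admissible_def)
    next
      case False
      then show ?thesis
        using A AG BG AB tr na inverse_block_upper_triangular[of A ?n ?B "p + m" t r]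
        by (auto simp: block_subgroup_iff GL_iff admissible_def)
    qed
    then show "?B \<in> block_subgroup p m q" using BG by (auto simp: block_subgroup_iff)
  next
    fix A B assume AB: "A \<in> block_subgroup p m q" "B \<in> block_subgroup p m q"
    have "(A * B) $$ (t, r) = 0" if tr: "t < ?n" "r < ?n" and na: "\<not> admissible p m t r" for t r
    proof -
      have "A $$ (t, k) * B $$ (k, r) = 0" if "k < ?n" for k
        using AB tr na that by (cases "admissible p m t k") (auto simp: block_subgroup_iff admissible_def)
      then show ?thesis
        using AB tr by (subst mult_mat_entry[where n = ?n]) (auto simp: block_subgroup_iff GL_iff intro!: sum.neutral)
    qed
    then show "A \<otimes>\<^bsub>GL ?n\<^esub> B \<in> block_subgroup p m q"
      using AB GL_mult by (auto simp: block_subgroup_iff)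
  qed
qed

lemma upper_tri_subgroup_iff:
  "A \<in> upper_tri_subgroup n \<longleftrightarrow>
     A \<in> carrier (GL n) \<and> (\<forall>r<n. \<forall>c<r. A $$ (r, c) = 0)"
  by (auto simp: upper_tri_subgroup_def upper_triangular_def GL_iff)

lemma subgroup_upper_tri: "subgroup (upper_tri_subgroup n) (GL n)"
proof -
  interpret group "GL n" by (rule group_GL)
  show ?thesis
  proof (rule subgroupI)
    show "upper_tri_subgroup n \<subseteq> carrier (GL n)" by (auto simp: upper_tri_subgroup_def)
    have "1\<^sub>m n \<in> upper_tri_subgroup n" by (auto simp: upper_tri_subgroup_iff GL_iff)
    then show "upper_tri_subgroup n \<noteq> {}" by blast
  next
    fix A assume A: "A \<in> upper_tri_subgroup n"
    let ?B = "inv\<^bsub>GL n\<^esub> A"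
    have AG: "A \<in> carrier (GL n)" and BG: "?B \<in> carrier (GL n)" and AB: "A * ?B = 1\<^sub>m n"
      using A r_inv[of A] by (auto simp: upper_tri_subgroup_iff)
    have "?B $$ (r, c) = 0" if "r < n" "c < r" for r c
      using A AG BG AB that inverse_block_upper_triangular[of A n ?B r r c]
      by (auto simp: upper_tri_subgroup_iff GL_iff)
    then show "?B \<in> upper_tri_subgroup n" using BG by (auto simp: upper_tri_subgroup_iff)
  next
    fix A B assume AB: "A \<in> upper_tri_subgroup n" "B \<in> upper_tri_subgroup n"
    have "(A * B) $$ (r, c) = 0" if rc: "r < n" "c < r" for r c
    proof -
      have "A $$ (r, k) * B $$ (k, c) = 0" if "k < n" for k
        using AB rc that by (cases "k < r") (auto simp: upper_tri_subgroup_iff)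
      then show ?thesis
        using AB rc by (subst mult_mat_entry[where n = n]) (auto simp: upper_tri_subgroup_iff GL_iff intro!: sum.neutral)
    qed
    then show "A \<otimes>\<^bsub>GL n\<^esub> B \<in> upper_tri_subgroup n"
      using AB GL_mult by (auto simp: upper_tri_subgroup_iff)
  qed
qed

text \<open>Two matrices are related if they lie in the same double coset, equivalently if the flags that
  they represent lie in the same orbit.\<close>

definition same_orbit :: "nat \<Rightarrow> nat \<Rightarrow> nat \<Rightarrow> complex mat \<Rightarrow> complex mat \<Rightarrow> bool" where
  "same_orbit p m q M M' \<longleftrightarrow>
     (\<exists>s \<in> block_subgroup p m q. \<exists>b \<in> upper_tri_subgroup (p + m + q). M' = s * M * b)"

lemma same_orbit_refl:
  assumes "M \<in> carrier (GL (p + m + q))"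
  shows "same_orbit p m q M M"
  unfolding same_orbit_def
  using assms subgroup.one_closed[OF subgroup_block] subgroup.one_closed[OF subgroup_upper_tri]
  by (intro bexI[of _ "1\<^sub>m (p + m + q)"]) (auto simp: GL_iff)

lemma same_orbit_trans:
  assumes M: "M \<in> carrier (GL (p + m + q))"
    and "same_orbit p m q M M'" "same_orbit p m q M' M''"
  shows "same_orbit p m q M M''"
proof -
  let ?n = "p + m + q"
  obtain s b s' b' where sb: "s \<in> block_subgroup p m q" "s' \<in> block_subgroup p m q"
    "b \<in> upper_tri_subgroup ?n" "b' \<in> upper_tri_subgroup ?n"
    and eq: "M' = s * M * b" "M'' = s' * M' * b'"
    using assms(2,3) unfolding same_orbit_def by blast
  have c: "s \<in> carrier_mat ?n ?n" "s' \<in> carrier_mat ?n ?n" "b \<in> carrier_mat ?n ?n"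
    "b' \<in> carrier_mat ?n ?n" "M \<in> carrier_mat ?n ?n"
    using sb M by (auto simp: block_subgroup_iff upper_tri_subgroup_iff GL_iff)
  have "s' * (s * M * b) * b' = s' * (s * M) * (b * b')"
    using c by (smt (verit) assoc_mult_mat mult_carrier_mat)
  also have "\<dots> = (s' * s) * M * (b * b')"
    using c by (smt (verit) assoc_mult_mat mult_carrier_mat)
  finally have "M'' = (s' * s) * M * (b * b')" using eq by simp
  moreover have "s' * s \<in> block_subgroup p m q" "b * b' \<in> upper_tri_subgroup ?n"
    using sb subgroup.m_closed[OF subgroup_block] subgroup.m_closed[OF subgroup_upper_tri] by fastforce+
  ultimately show ?thesis unfolding same_orbit_def by blast
qed

lemma same_orbit_sym:
  assumes M: "M \<in> carrier (GL (p + m + q))" and "same_orbit p m q M M'"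
  shows "same_orbit p m q M' M"
proof -
  let ?n = "p + m + q"
  interpret group "GL ?n" by (rule group_GL)
  obtain s b where sb: "s \<in> block_subgroup p m q" "b \<in> upper_tri_subgroup ?n"
    and eq: "M' = s * M * b"
    using assms(2) unfolding same_orbit_def by blast
  have c: "s \<in> carrier (GL ?n)" "b \<in> carrier (GL ?n)"
    using sb by (auto simp: block_subgroup_iff upper_tri_subgroup_iff)
  have eq': "M' = (s \<otimes>\<^bsub>GL ?n\<^esub> M) \<otimes>\<^bsub>GL ?n\<^esub> b" using eq by simp
  then have "M = (inv\<^bsub>GL ?n\<^esub> s \<otimes>\<^bsub>GL ?n\<^esub> M') \<otimes>\<^bsub>GL ?n\<^esub> inv\<^bsub>GL ?n\<^esub> b"
    using c M by (metis inv_closed inv_solve_left inv_solve_right m_assoc m_closed)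
  then have "M = inv\<^bsub>GL ?n\<^esub> s * M' * inv\<^bsub>GL ?n\<^esub> b" by simp
  moreover have "inv\<^bsub>GL ?n\<^esub> s \<in> block_subgroup p m q" "inv\<^bsub>GL ?n\<^esub> b \<in> upper_tri_subgroup ?n"
    using sb subgroup.m_inv_closed[OF subgroup_block] subgroup.m_inv_closed[OF subgroup_upper_tri]
    by blast+
  ultimately show ?thesis unfolding same_orbit_def by blast
qed

section \<open>Reduction to clan shape\<close>

definition replace_column :: "nat \<Rightarrow> nat \<Rightarrow> (nat \<Rightarrow> complex) \<Rightarrow> complex mat" where
  "replace_column n j u = mat n n (\<lambda>(t, k). if k = j then u t else if t = k then 1 else 0)"

lemma replace_column_GL:
  assumes j: "j < n" and u: "u j \<noteq> 0"
  shows "replace_column n j u \<in> carrier (GL n)"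
proof -
  let ?E = "replace_column n j u"
  have E: "?E \<in> carrier_mat n n" by (simp add: replace_column_def)
  have "v = 0\<^sub>v n" if v: "v \<in> carrier_vec n" and Ev: "?E *\<^sub>v v = 0\<^sub>v n" for v
  proof -
    have sum: "u t * v $ j + (if t = j then 0 else v $ t) = 0" if t: "t < n" for t
    proof -
      have "0 = (\<Sum>k<n. ?E $$ (t, k) * v $ k)"
        using mult_mat_vec_entry[OF E v t] Ev t by simp
      also have "\<dots> = (\<Sum>k<n. (if k = j then u t * v $ j else 0)
                             + (if k = t then if t = j then 0 else v $ t else 0))"
        by (rule sum.cong) (use t in \<open>auto simp: replace_column_def\<close>)
      also have "\<dots> = u t * v $ j + (if t = j then 0 else v $ t)"
        using t j by (simp add: sum.distrib)
      finally show ?thesis by simp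
    qed
    have "v $ j = 0" using sum[OF j] u by simp
    then have "v $ t = 0" if "t < n" for t
      using sum[OF that] by (cases "t = j") simp_all
    then show ?thesis using v by (intro eq_vecI) auto
  qed
  then have "det ?E \<noteq> 0" using det_0_iff_vec_prod_zero[OF E] by blast
  then show ?thesis using E by (simp add: GL_iff)
qed

text \<open>Right multiplication by an upper triangular matrix allows a column to be replaced by any
  combination of itself and earlier columns in which it occurs itself.\<close>

lemma column_operation:
  assumes M: "M \<in> carrier (GL (p + m + q))" and j: "j < p + m + q"
    and c: "c j \<noteq> 0" "\<And>k. j < k \<Longrightarrow> k < p + m + q \<Longrightarrow> c k = 0"
  obtains M' where "M' \<in> carrier (GL (p + m + q))" "same_orbit p m q M M'"
    "\<And>r. r < p + m + q \<Longrightarrow> M' $$ (r, j) = (\<Sum>k<p + m + q. M $$ (r, k) * c k)"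
    "\<And>r k. r < p + m + q \<Longrightarrow> k < p + m + q \<Longrightarrow> k \<noteq> j \<Longrightarrow> M' $$ (r, k) = M $$ (r, k)"
proof -
  let ?n = "p + m + q"
  let ?b = "replace_column ?n j c"
  have b: "?b \<in> upper_tri_subgroup ?n"
    using replace_column_GL[of j ?n c] j c by (auto simp: upper_tri_subgroup_iff replace_column_def)
  have bc: "?b \<in> carrier_mat ?n ?n" and Mc: "M \<in> carrier_mat ?n ?n"
    using M by (auto simp: replace_column_def GL_iff)
  have "same_orbit p m q M (M * ?b)"
    unfolding same_orbit_def
    using b Mc subgroup.one_closed[OF subgroup_block, of p m q]
    by (intro bexI[of _ "1\<^sub>m ?n"] bexI[of _ ?b]) auto
  moreover have "M * ?b \<in> carrier (GL ?n)"
    using M b by (auto simp: upper_tri_subgroup_iff intro: GL_mult)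
  moreover have "(M * ?b) $$ (r, j) = (\<Sum>k<?n. M $$ (r, k) * c k)" if "r < ?n" for r
    using that j by (subst mult_mat_entry[OF Mc bc]) (auto simp: replace_column_def intro!: sum.cong)
  moreover have "(M * ?b) $$ (r, k) = M $$ (r, k)" if "r < ?n" "k < ?n" "k \<noteq> j" for r k
  proof -
    have "(M * ?b) $$ (r, k) = (\<Sum>l<?n. if l = k then M $$ (r, l) else 0)"
      unfolding mult_mat_entry[OF Mc bc that(1,2)]
      by (rule sum.cong) (use that in \<open>auto simp: replace_column_def\<close>)
    then show ?thesis using that by simp
  qed
  ultimately show ?thesis using that by blast
qed

text \<open>Elimination in column \<open>c\<close> with pivot \<open>(r, c)\<close>, restricted to the rows that the block shape allows
  to change. Columns with a zero in row \<open>r\<close> do not change at all.\<close>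

lemma pivot:
  assumes M: "M \<in> carrier (GL (p + m + q))" and r: "r < p + m + q" and c: "c < p + m + q"
    and nz: "M $$ (r, c) \<noteq> 0"
  obtains M' where "M' \<in> carrier (GL (p + m + q))" "same_orbit p m q M M'"
    "\<And>t k. t < p + m + q \<Longrightarrow> k < p + m + q \<Longrightarrow> M' $$ (t, k) =
       (if t = r then M $$ (r, k) / M $$ (r, c)
        else if admissible p m t r then M $$ (t, k) - M $$ (t, c) / M $$ (r, c) * M $$ (r, k)
        else M $$ (t, k))"
proof -
  let ?n = "p + m + q"
  define u where "u t = (if t = r then 1 / M $$ (r, c)
    else if admissible p m t r then - M $$ (t, c) / M $$ (r, c) else 0)" for t
  let ?s = "replace_column ?n r u"
  have ur: "u r \<noteq> 0" using nz by (simp add: u_def)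
  have s: "?s \<in> block_subgroup p m q"
    using replace_column_GL[of r ?n u] r ur
    by (auto simp: block_subgroup_iff replace_column_def u_def) (auto simp: admissible_def)
  have sc: "?s \<in> carrier_mat ?n ?n" and Mc: "M \<in> carrier_mat ?n ?n"
    using M by (auto simp: replace_column_def GL_iff)
  have "same_orbit p m q M (?s * M)"
    unfolding same_orbit_def
    using s sc Mc subgroup.one_closed[OF subgroup_upper_tri, of ?n]
    by (intro bexI[of _ "?s"] bexI[of _ "1\<^sub>m ?n"]) auto
  moreover have "?s * M \<in> carrier (GL ?n)"
    using M s by (auto simp: block_subgroup_iff intro: GL_mult)
  moreover have "(?s * M) $$ (t, k) =
       (if t = r then M $$ (r, k) / M $$ (r, c)
        else if admissible p m t r then M $$ (t, k) - M $$ (t, c) / M $$ (r, c) * M $$ (r, k)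
        else M $$ (t, k))" if tk: "t < ?n" "k < ?n" for t k
  proof -
    have "(?s * M) $$ (t, k) = (\<Sum>l<?n. (if l = r then u t * M $$ (r, k) else 0)
                             + (if l = t then if t = r then 0 else M $$ (t, k) else 0))"
      unfolding mult_mat_entry[OF sc Mc tk]
      by (rule sum.cong) (use tk r in \<open>auto simp: replace_column_def\<close>)
    also have "\<dots> = u t * M $$ (r, k) + (if t = r then 0 else M $$ (t, k))"
      using tk r by (simp add: sum.distrib)
    finally show ?thesis by (simp add: u_def)
  qed
  ultimately show ?thesis using that by blast
qed

text \<open>The first \<open>i\<close> columns of \<open>M\<close> have clan shape: column \<open>k\<close> has a 1 in its leading row \<open>\<rho> k\<close>, and, if
  \<open>k \<in> L\<close>, a second 1 in row \<open>\<tau> k\<close> of the last block. The columns in \<open>L\<close> are the left-ends. The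
  partner of \<open>k \<in> L\<close> is the column whose leading row is \<open>\<tau> k\<close>; as long as there is none,
  \<open>k\<close> is waiting. A column outside \<open>L\<close> is a plus, an uncolored node, or one of a minus and a right-end,
  according to the block that contains its leading row; right-ends are those with \<open>\<rho> k \<in> \<tau> ` L\<close>.\<close>

definition clan_columns ::
    "nat \<Rightarrow> nat \<Rightarrow> nat \<Rightarrow> nat \<Rightarrow> complex mat \<Rightarrow> (nat \<Rightarrow> nat) \<Rightarrow> (nat \<Rightarrow> nat) \<Rightarrow> nat set \<Rightarrow> bool" where
  "clan_columns p m q i M \<rho> \<tau> L \<longleftrightarrow>
     L \<subseteq> {..<i} \<and> inj_on \<rho> {..<i} \<and> (\<forall>k<i. \<rho> k < p + m + q) \<and>
     (\<forall>k\<in>L. \<rho> k < p \<and> p + m \<le> \<tau> k \<and> \<tau> k < p + m + q) \<and> inj_on \<tau> L \<and>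
     (\<forall>k\<in>L. \<forall>j<i. \<tau> k = \<rho> j \<longrightarrow> k < j) \<and>
     (\<forall>k<i. \<forall>t<p + m + q. M $$ (t, k) = (if t = \<rho> k \<or> k \<in> L \<and> t = \<tau> k then 1 else 0))"

lemma clan_columnsD:
  assumes "clan_columns p m q i M \<rho> \<tau> L"
  shows "L \<subseteq> {..<i}" "inj_on \<rho> {..<i}" "\<And>k. k < i \<Longrightarrow> \<rho> k < p + m + q"
    "\<And>k. k \<in> L \<Longrightarrow> \<rho> k < p" "\<And>k. k \<in> L \<Longrightarrow> p + m \<le> \<tau> k" "\<And>k. k \<in> L \<Longrightarrow> \<tau> k < p + m + q"
    "inj_on \<tau> L" "\<And>k j. k \<in> L \<Longrightarrow> j < i \<Longrightarrow> \<tau> k = \<rho> j \<Longrightarrow> k < j"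
    "\<And>k t. k < i \<Longrightarrow> t < p + m + q \<Longrightarrow>
       M $$ (t, k) = (if t = \<rho> k \<or> k \<in> L \<and> t = \<tau> k then 1 else 0)"
  using assms unfolding clan_columns_def by blast+

lemma clan_columns_cong:
  assumes "clan_columns p m q i M \<rho> \<tau> L"
    and "\<And>t k. t < p + m + q \<Longrightarrow> k < i \<Longrightarrow> M' $$ (t, k) = M $$ (t, k)"
  shows "clan_columns p m q i M' \<rho> \<tau> L"
  using assms by (simp add: clan_columns_def)

lemma clan_columns_add_single:
  assumes C: "clan_columns p m q i M \<rho> \<tau> L" and r: "r < p + m + q" "r \<notin> \<rho> ` {..<i}"
    and col: "\<And>t. t < p + m + q \<Longrightarrow> M $$ (t, i) = (if t = r then 1 else 0)"
  shows "clan_columns p m q (Suc i) M (\<rho>(i := r)) \<tau> L"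
proof -
  note D = clan_columnsD[OF C]
  have iL: "i \<notin> L" using D(1) by auto
  have "inj_on (\<rho>(i := r)) {..<Suc i}"
    using D(2) r(2) by (auto simp: inj_on_def less_Suc_eq)
  then show ?thesis
    unfolding clan_columns_def using D r col iL
    by (auto simp: less_Suc_eq)
qed

lemma clan_columns_add_left_end:
  assumes C: "clan_columns p m q i M \<rho> \<tau> L"
    and r: "r < p" "r \<notin> \<rho> ` {..<i}"
    and r': "p + m \<le> r'" "r' < p + m + q" "r' \<notin> \<rho> ` {..<i}" "r' \<notin> \<tau> ` L"
    and col: "\<And>t. t < p + m + q \<Longrightarrow> M $$ (t, i) = (if t = r \<or> t = r' then 1 else 0)"
  shows "clan_columns p m q (Suc i) M (\<rho>(i := r)) (\<tau>(i := r')) (insert i L)"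
proof -
  note D = clan_columnsD[OF C]
  have iL: "i \<notin> L" using D(1) by auto
  have 1: "inj_on (\<rho>(i := r)) {..<Suc i}"
    using D(2) r(2) by (auto simp: inj_on_def less_Suc_eq)
  have 2: "inj_on (\<tau>(i := r')) (insert i L)"
    using D(7) r'(4) iL by (auto simp: inj_on_def)
  have 3: "(\<tau>(i := r')) k = (\<rho>(i := r)) j \<longrightarrow> k < j" if "k \<in> insert i L" "j < Suc i" for k j
    using that D(1) D(8)[of k j] r r' D(4)[of k] D(5)[of k] by (auto simp: less_Suc_eq)
  have 4: "M $$ (t, k) = (if t = (\<rho>(i := r)) k \<or> k \<in> insert i L \<and> t = (\<tau>(i := r')) k then 1 else 0)"
    if "k < Suc i" "t < p + m + q" for k t
    using that D(9)[of k t] col[of t] by (cases "k = i") (auto simp: less_Suc_eq)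
  have 5: "insert i L \<subseteq> {..<Suc i}" using D(1) by auto
  have 6: "(\<rho>(i := r)) k < p + m + q" if "k < Suc i" for k
    using that D(3)[of k] r by (auto simp: less_Suc_eq)
  have 7: "(\<rho>(i := r)) k < p \<and> p + m \<le> (\<tau>(i := r')) k \<and> (\<tau>(i := r')) k < p + m + q"
    if "k \<in> insert i L" for k
    using that D(4)[of k] D(5)[of k] D(6)[of k] r r' iL by (cases "k = i") auto
  have q3: "\<forall>k\<in>insert i L. \<forall>j<Suc i. (\<tau>(i := r')) k = (\<rho>(i := r)) j \<longrightarrow> k < j"
    by (intro ballI allI impI) (rule 3[rule_format])
  have q4: "\<forall>k<Suc i. \<forall>t<p + m + q. M $$ (t, k) =
      (if t = (\<rho>(i := r)) k \<or> k \<in> insert i L \<and> t = (\<tau>(i := r')) k then 1 else 0)"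
    by (intro allI impI) (rule 4)
  have q6: "\<forall>k<Suc i. (\<rho>(i := r)) k < p + m + q" by (intro allI impI) (rule 6)
  have q7: "\<forall>k\<in>insert i L. (\<rho>(i := r)) k < p \<and> p + m \<le> (\<tau>(i := r')) k \<and>
      (\<tau>(i := r')) k < p + m + q"
    by (intro ballI) (rule 7)
  show ?thesis unfolding clan_columns_def by (intro conjI 5 1 q6 q7 2 q3 q4)
qed

text \<open>The combination of the left-end columns with coefficients \<open>a\<close> has the coefficient \<open>a k\<close> in both
  rows of the left-end \<open>k\<close>, since these rows are pairwise distinct.\<close>

lemma left_end_combination:
  assumes C: "clan_columns p m q i M \<rho> \<tau> L" and t: "t < p + m + q"
  shows "k \<in> L \<Longrightarrow> t = \<tau> k \<or> t = \<rho> k \<Longrightarrow> (\<Sum>l\<in>L. M $$ (t, l) * a l) = a k"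
    and "t \<notin> \<rho> ` L \<Longrightarrow> t \<notin> \<tau> ` L \<Longrightarrow> (\<Sum>l\<in>L. M $$ (t, l) * a l) = 0"
proof -
  note D = clan_columnsD[OF C]
  have fin: "finite L" using D(1) finite_subset by blast
  have entry: "M $$ (t, l) = (if t = \<rho> l \<or> t = \<tau> l then 1 else 0)" if "l \<in> L" for l
    using D(1) D(9)[OF _ t, of l] that by auto
  show "(\<Sum>l\<in>L. M $$ (t, l) * a l) = a k" if k: "k \<in> L" "t = \<tau> k \<or> t = \<rho> k"
  proof -
    have neq: "\<rho> x \<noteq> \<tau> y" if "x \<in> L" "y \<in> L" for x y using D(4)[OF that(1)] D(5)[OF that(2)] by simp
    have "M $$ (t, l) = (if l = k then 1 else 0)" if l: "l \<in> L" for l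
    proof -
      have "\<rho> l = \<rho> k \<longleftrightarrow> l = k" "\<tau> l = \<tau> k \<longleftrightarrow> l = k"
        using D(1) l k(1) inj_on_eq_iff[OF D(2), of l k] inj_on_eq_iff[OF D(7), of l k] by auto
      then show ?thesis using entry[OF l] k neq[of k l] neq[of l k] l by auto
    qed
    then have "(\<Sum>l\<in>L. M $$ (t, l) * a l) = (\<Sum>l\<in>L. if l = k then a l else 0)"
      by (intro sum.cong) auto
    then show ?thesis using fin k by simp
  qed
  show "(\<Sum>l\<in>L. M $$ (t, l) * a l) = 0" if "t \<notin> \<rho> ` L" "t \<notin> \<tau> ` L"
    by (rule sum.neutral) (use that entry in auto)
qed

text \<open>The leading rows are cleared from left to right. Subtracting column \<open>J\<close> disturbs only its rows
  \<open>\<rho> J\<close> and \<open>\<tau> J\<close>, and \<open>\<tau> J\<close> can only be the leading row of a later column.\<close>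

lemma clear_occupied_rows:
  assumes M: "M \<in> carrier (GL (p + m + q))" and C: "clan_columns p m q i M \<rho> \<tau> L"
    and i: "i < p + m + q" and J: "J \<le> i"
  shows "\<exists>M'. M' \<in> carrier (GL (p + m + q)) \<and> same_orbit p m q M M' \<and>
    clan_columns p m q i M' \<rho> \<tau> L \<and> (\<forall>k<J. M' $$ (\<rho> k, i) = 0)"
  using J
proof (induction J)
  case 0
  then show ?case using M C same_orbit_refl by blast
next
  case (Suc J)
  let ?n = "p + m + q"
  obtain M1 where M1: "M1 \<in> carrier (GL ?n)" "same_orbit p m q M M1"
    and C1: "clan_columns p m q i M1 \<rho> \<tau> L" and zero: "\<And>k. k < J \<Longrightarrow> M1 $$ (\<rho> k, i) = 0"
    using Suc by (meson Suc_leD)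
  note D = clan_columnsD[OF C1]
  define c where "c k = (if k = i then 1 else if k = J then - M1 $$ (\<rho> J, i) else 0)" for k
  have Ji: "J < i" using Suc.prems by simp
  have c: "c i \<noteq> 0" "\<And>k. i < k \<Longrightarrow> k < ?n \<Longrightarrow> c k = 0" using Ji by (simp_all add: c_def)
  obtain M2 where M2: "M2 \<in> carrier (GL ?n)" "same_orbit p m q M1 M2"
    and col: "\<And>t. t < ?n \<Longrightarrow> M2 $$ (t, i) = (\<Sum>k<?n. M1 $$ (t, k) * c k)"
    and others: "\<And>t k. t < ?n \<Longrightarrow> k < ?n \<Longrightarrow> k \<noteq> i \<Longrightarrow> M2 $$ (t, k) = M1 $$ (t, k)"
    using column_operation[OF M1(1) i, of c, OF c] by blast
  have C2: "clan_columns p m q i M2 \<rho> \<tau> L"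
    by (rule clan_columns_cong[OF C1]) (use others i in auto)
  have col': "M2 $$ (t, i) = M1 $$ (t, i) - M1 $$ (\<rho> J, i) * M1 $$ (t, J)" if "t < ?n" for t
  proof -
    have "M2 $$ (t, i) = (\<Sum>k<?n. (if k = i then M1 $$ (t, i) else 0)
        + (if k = J then - M1 $$ (\<rho> J, i) * M1 $$ (t, J) else 0))"
      unfolding col[OF that] by (rule sum.cong) (use Ji in \<open>auto simp: c_def\<close>)
    also have "\<dots> = M1 $$ (t, i) - M1 $$ (\<rho> J, i) * M1 $$ (t, J)"
      using i Ji by (simp add: sum.distrib)
    finally show ?thesis .
  qed
  have "M2 $$ (\<rho> k, i) = 0" if k: "k < Suc J" for k
  proof (cases "k = J")
    case True
    then show ?thesis using col'[of "\<rho> J"] D(9)[of J "\<rho> J"] D(3)[of J] Ji by simp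
  next
    case False
    then have kJ: "k < J" using k by simp
    have "\<rho> k \<noteq> \<rho> J" using D(2) kJ Ji by (auto simp: inj_on_def)
    moreover have "\<not> (J \<in> L \<and> \<rho> k = \<tau> J)" using D(8)[of J k] kJ Ji by fastforce
    ultimately have "M1 $$ (\<rho> k, J) = 0" using D(9)[of J "\<rho> k"] D(3)[of k] kJ Ji by simp
    then show ?thesis using col'[of "\<rho> k"] zero[OF kJ] D(3)[of k] kJ Ji by simp
  qed
  then show ?case using M2 C2 same_orbit_trans[OF M M1(2) M2(2)] by blast
qed

text \<open>A row in which all old columns vanish can serve as pivot without changing the old columns.\<close>

lemma pivot_new_row:
  assumes M: "M \<in> carrier (GL (p + m + q))" and C: "clan_columns p m q i M \<rho> \<tau> L"
    and i: "i < p + m + q" and r: "r < p + m + q" "M $$ (r, i) \<noteq> 0"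
      "r \<notin> \<rho> ` {..<i}" "r \<notin> \<tau> ` L"
  obtains M' where "M' \<in> carrier (GL (p + m + q))" "same_orbit p m q M M'"
    "clan_columns p m q i M' \<rho> \<tau> L"
    "\<And>t. t < p + m + q \<Longrightarrow> M' $$ (t, i) =
       (if t = r then 1 else if admissible p m t r then 0 else M $$ (t, i))"
proof -
  let ?n = "p + m + q"
  note D = clan_columnsD[OF C]
  obtain M' where M': "M' \<in> carrier (GL ?n)" "same_orbit p m q M M'"
    and e: "\<And>t k. t < ?n \<Longrightarrow> k < ?n \<Longrightarrow> M' $$ (t, k) =
       (if t = r then M $$ (r, k) / M $$ (r, i)
        else if admissible p m t r then M $$ (t, k) - M $$ (t, i) / M $$ (r, i) * M $$ (r, k)
        else M $$ (t, k))"
    using pivot[OF M r(1) i r(2)] by blast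
  have zero: "M $$ (r, k) = 0" if "k < i" for k
    using that D(9)[OF that r(1)] r(3,4) by auto
  have "clan_columns p m q i M' \<rho> \<tau> L"
    by (rule clan_columns_cong[OF C]) (use e zero i in auto)
  then show ?thesis using that M' e[OF _ i] r(2) by simp
qed

text \<open>After the leading rows are cleared, the kind of the new node depends on whether the new column
  has a component in the first block and one in the last block outside the rows of \<open>\<tau>\<close>.\<close>

lemma reduce_next_column:
  assumes M: "M \<in> carrier (GL (p + m + q))" and C: "clan_columns p m q i M \<rho> \<tau> L"
    and i: "i < p + m + q"
  shows "\<exists>M' \<rho>' \<tau>' L'. M' \<in> carrier (GL (p + m + q)) \<and> same_orbit p m q M M' \<and>
    clan_columns p m q (Suc i) M' \<rho>' \<tau>' L'"
proof -
  let ?n = "p + m + q"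
  obtain N where N: "N \<in> carrier (GL ?n)" and MN: "same_orbit p m q M N"
    and CN: "clan_columns p m q i N \<rho> \<tau> L" and zero: "\<And>k. k < i \<Longrightarrow> N $$ (\<rho> k, i) = 0"
    using clear_occupied_rows[OF M C i order_refl] by blast
  note D = clan_columnsD[OF CN]
  have fin: "finite L" using D(1) finite_subset by blast
  have Ln: "l < ?n" if "l \<in> L" for l using D(1) that i by auto
  have unused: "t \<notin> \<rho> ` {..<i}" if "N $$ (t, i) \<noteq> 0" for t
    using that zero by auto
  have trans: "\<exists>M' \<rho>' \<tau>' L'. M' \<in> carrier (GL ?n) \<and> same_orbit p m q M M' \<and>
      clan_columns p m q (Suc i) M' \<rho>' \<tau>' L'"
    if "M' \<in> carrier (GL ?n)" "same_orbit p m q N M'" "clan_columns p m q (Suc i) M' \<rho>' \<tau>' L'"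
    for M' \<rho>' \<tau>' L'
    using that same_orbit_trans[OF M MN] by blast
  consider
      (left) r r' where "r < p" "N $$ (r, i) \<noteq> 0"
        "p + m \<le> r'" "r' < ?n" "N $$ (r', i) \<noteq> 0" "r' \<notin> \<tau> ` L"
    | (minus) r' where "\<And>t. t < p \<Longrightarrow> N $$ (t, i) = 0"
        "p + m \<le> r'" "r' < ?n" "N $$ (r', i) \<noteq> 0" "r' \<notin> \<tau> ` L"
    | (plus) r where "r < p" "N $$ (r, i) \<noteq> 0"
        "\<And>t. p + m \<le> t \<Longrightarrow> t < ?n \<Longrightarrow> t \<notin> \<tau> ` L \<Longrightarrow> N $$ (t, i) = 0"
    | (neither) "\<And>t. t < p \<Longrightarrow> N $$ (t, i) = 0"
        "\<And>t. p + m \<le> t \<Longrightarrow> t < ?n \<Longrightarrow> t \<notin> \<tau> ` L \<Longrightarrow> N $$ (t, i) = 0"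
    by blast
  then show ?thesis
  proof cases
    case left
    have "r \<notin> \<tau> ` L" using left(1) D(5) by force
    then obtain M1 where M1: "M1 \<in> carrier (GL ?n)" "same_orbit p m q N M1"
      and C1: "clan_columns p m q i M1 \<rho> \<tau> L"
      and e1: "\<And>t. t < ?n \<Longrightarrow> M1 $$ (t, i) =
        (if t = r then 1 else if admissible p m t r then 0 else N $$ (t, i))"
      using pivot_new_row[OF N CN i, of r] unused left by auto
    have "M1 $$ (r', i) \<noteq> 0" using e1[of r'] left by (auto simp: admissible_def)
    then obtain M2 where M2: "M2 \<in> carrier (GL ?n)" "same_orbit p m q M1 M2"
      and C2: "clan_columns p m q i M2 \<rho> \<tau> L"
      and e2: "\<And>t. t < ?n \<Longrightarrow> M2 $$ (t, i) =
        (if t = r' then 1 else if admissible p m t r' then 0 else M1 $$ (t, i))"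
      using pivot_new_row[OF M1(1) C1 i, of r'] unused left by auto
    have "M2 $$ (t, i) = (if t = r \<or> t = r' then 1 else 0)" if "t < ?n" for t
      using e1[OF that] e2[OF that] left by (auto simp: admissible_def)
    then have "clan_columns p m q (Suc i) M2 (\<rho>(i := r)) (\<tau>(i := r')) (insert i L)"
      using clan_columns_add_left_end[OF C2] left unused by blast
    then show ?thesis using trans[OF M2(1)] same_orbit_trans[OF N M1(2) M2(2)] by blast
  next
    case minus
    then obtain M1 where M1: "M1 \<in> carrier (GL ?n)" "same_orbit p m q N M1"
      and C1: "clan_columns p m q i M1 \<rho> \<tau> L"
      and e1: "\<And>t. t < ?n \<Longrightarrow> M1 $$ (t, i) =
        (if t = r' then 1 else if admissible p m t r' then 0 else N $$ (t, i))"
      using pivot_new_row[OF N CN i, of r'] unused by blast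
    have "M1 $$ (t, i) = (if t = r' then 1 else 0)" if "t < ?n" for t
      using e1[OF that] minus by (auto simp: admissible_def)
    then have "clan_columns p m q (Suc i) M1 (\<rho>(i := r')) \<tau> L"
      using clan_columns_add_single[OF C1] minus unused by blast
    then show ?thesis using trans[OF M1] by blast
  next
    case plus
    \<comment> \<open>The part in the rows of \<open>\<tau>\<close> is removed by subtracting left-ends. This changes the first block
        only in occupied rows, so the component in row \<open>r\<close> survives.\<close>
    define c where "c k = (if k = i then 1 else if k \<in> L then - N $$ (\<tau> k, i) else 0)" for k
    have c: "c i \<noteq> 0" "\<And>k. i < k \<Longrightarrow> k < ?n \<Longrightarrow> c k = 0" using D(1) by (auto simp: c_def)
    obtain M1 where M1: "M1 \<in> carrier (GL ?n)" "same_orbit p m q N M1"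
      and col: "\<And>t. t < ?n \<Longrightarrow> M1 $$ (t, i) = (\<Sum>k<?n. N $$ (t, k) * c k)"
      and others: "\<And>t k. t < ?n \<Longrightarrow> k < ?n \<Longrightarrow> k \<noteq> i \<Longrightarrow> M1 $$ (t, k) = N $$ (t, k)"
      using column_operation[OF N i, of c, OF c] by blast
    have C1: "clan_columns p m q i M1 \<rho> \<tau> L"
      by (rule clan_columns_cong[OF CN]) (use others i in auto)
    have iL: "i \<notin> L" using D(1) by auto
    have col': "M1 $$ (t, i) = N $$ (t, i) - (\<Sum>l\<in>L. N $$ (t, l) * N $$ (\<tau> l, i))"
      if "t < ?n" for t
    proof -
      have "M1 $$ (t, i) = (\<Sum>k\<in>insert i L. N $$ (t, k) * c k)"
        unfolding col[OF that] by (rule sum.mono_neutral_right) (use Ln i in \<open>auto simp: c_def\<close>)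
      also have "\<dots> = N $$ (t, i) + (\<Sum>k\<in>L. N $$ (t, k) * c k)"
        using fin iL by (simp add: c_def)
      also have "(\<Sum>k\<in>L. N $$ (t, k) * c k) = (\<Sum>k\<in>L. - (N $$ (t, k) * N $$ (\<tau> k, i)))"
        by (rule sum.cong) (use iL in \<open>auto simp: c_def\<close>)
      finally show ?thesis by (simp add: sum_negf)
    qed
    have rL: "r \<notin> \<tau> ` L" using plus(1) D(5) by force
    have r\<rho>: "r \<notin> \<rho> ` {..<i}" using unused plus by blast
    then have "r \<notin> \<rho> ` L" using D(1) by blast
    then have "M1 $$ (r, i) \<noteq> 0"
      using col'[of r] left_end_combination(2)[OF CN _ _ rL] plus by simp
    then obtain M2 where M2: "M2 \<in> carrier (GL ?n)" "same_orbit p m q M1 M2"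
      and C2: "clan_columns p m q i M2 \<rho> \<tau> L"
      and e2: "\<And>t. t < ?n \<Longrightarrow> M2 $$ (t, i) =
        (if t = r then 1 else if admissible p m t r then 0 else M1 $$ (t, i))"
      using pivot_new_row[OF M1(1) C1 i, of r] r\<rho> rL plus(1) by auto
    have low: "M1 $$ (t, i) = 0" if t: "p + m \<le> t" "t < ?n" for t
    proof (cases "t \<in> \<tau> ` L")
      case True
      then obtain k where k: "k \<in> L" "t = \<tau> k" by blast
      then show ?thesis using col'[OF t(2)] left_end_combination(1)[OF CN t(2) k(1)] by simp
    next
      case False
      moreover have "t \<notin> \<rho> ` L" using t D(4) by force
      ultimately show ?thesis using col'[OF t(2)] left_end_combination(2)[OF CN t(2)] plus t by simp
    qed
    have "M2 $$ (t, i) = (if t = r then 1 else 0)" if "t < ?n" for t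
      using e2[OF that] plus(1) low[OF _ that] by (auto simp: admissible_def)
    then have "clan_columns p m q (Suc i) M2 (\<rho>(i := r)) \<tau> L"
      using clan_columns_add_single[OF C2] plus(1) r\<rho> by simp
    then show ?thesis using trans[OF M2(1)] same_orbit_trans[OF N M1(2) M2(2)] by blast
  next
    case neither
    show ?thesis
    proof (cases "\<exists>k\<in>L. N $$ (\<tau> k, i) \<noteq> 0")
      case False
      then have low: "N $$ (t, i) = 0" if "p + m \<le> t" "t < ?n" for t
        using neither(2)[OF that] by (cases "t \<in> \<tau> ` L") auto
      \<comment> \<open>The column now lies in the middle block, and it is not zero because the matrix is invertible.\<close>
      have "\<exists>r<?n. N $$ (r, i) \<noteq> 0"
      proof (rule ccontr)
        assume "\<not> ?thesis"
        then have z: "N *\<^sub>v unit_vec ?n i = 0\<^sub>v ?n"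
          using N i by (intro eq_vecI) (auto simp: GL_iff)
        have Nc: "N \<in> carrier_mat ?n ?n" and detN: "det N \<noteq> 0" using N by (auto simp: GL_iff)
        have "det N = 0"
          unfolding det_0_iff_vec_prod_zero[OF Nc]
          using z i by (intro exI[of _ "unit_vec ?n i"]) simp
        then show False using detN by simp
      qed
      then obtain r where r: "r < ?n" "N $$ (r, i) \<noteq> 0" by blast
      then have rm: "p \<le> r" "r < p + m" using neither(1)[of r] low[of r] by force+
      have "r \<notin> \<tau> ` L" using rm D(5) by force
      then obtain M1 where M1: "M1 \<in> carrier (GL ?n)" "same_orbit p m q N M1"
        and C1: "clan_columns p m q i M1 \<rho> \<tau> L"
        and e1: "\<And>t. t < ?n \<Longrightarrow> M1 $$ (t, i) =
          (if t = r then 1 else if admissible p m t r then 0 else N $$ (t, i))"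
        using pivot_new_row[OF N CN i r] unused r by blast
      have "M1 $$ (t, i) = (if t = r then 1 else 0)" if "t < ?n" for t
        using e1[OF that] rm neither(1) low[OF _ that] by (auto simp: admissible_def)
      then have "clan_columns p m q (Suc i) M1 (\<rho>(i := r)) \<tau> L"
        using clan_columns_add_single[OF C1] r unused by blast
      then show ?thesis using trans[OF M1] by blast
    next
      case True
      \<comment> \<open>The latest left-end \<open>k0\<close> that occurs becomes the partner. Its column is replaced by the
          combination \<open>w\<close> of left-ends that agrees with the new column in the last block, so that the
          difference of both columns lies in \<open>V\<^sub>1\<close>.\<close>
      let ?K = "{k \<in> L. N $$ (\<tau> k, i) \<noteq> 0}"
      define k0 where "k0 = Max ?K"
      have Kfin: "finite ?K" and Kne: "?K \<noteq> {}" using fin True by auto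
      have "k0 \<in> ?K" unfolding k0_def by (rule Max_in[OF Kfin Kne])
      then have k0: "k0 \<in> L" and d: "N $$ (\<tau> k0, i) \<noteq> 0" by auto
      have k0i: "k0 < i" using k0 D(1) by auto
      have max: "N $$ (\<tau> k, i) = 0" if "k \<in> L" "k0 < k" for k
        using Max_ge[OF Kfin, of k] that unfolding k0_def by fastforce
      have \<tau>n: "\<tau> k0 < ?n" and \<rho>n: "\<rho> k0 < ?n" using D(3,6) k0 k0i by auto
      have \<tau>new: "\<tau> k0 \<notin> \<rho> ` {..<i}" using unused[OF d] .
      define c where "c k = (if k \<in> L then N $$ (\<tau> k, i) else 0)" for k
      have k0n: "k0 < ?n" using k0i i by simp
      have c: "c k0 \<noteq> 0" "\<And>k. k0 < k \<Longrightarrow> k < ?n \<Longrightarrow> c k = 0"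
        using k0 d max by (auto simp: c_def)
      define w where "w t = (\<Sum>l\<in>L. N $$ (t, l) * N $$ (\<tau> l, i))" for t
      obtain M1 where M1: "M1 \<in> carrier (GL ?n)" "same_orbit p m q N M1"
        and col: "\<And>t. t < ?n \<Longrightarrow> M1 $$ (t, k0) = (\<Sum>k<?n. N $$ (t, k) * c k)"
        and others: "\<And>t k. t < ?n \<Longrightarrow> k < ?n \<Longrightarrow> k \<noteq> k0 \<Longrightarrow> M1 $$ (t, k) = N $$ (t, k)"
        using column_operation[OF N k0n, of c, OF c] by blast
      have col': "M1 $$ (t, k0) = w t" if "t < ?n" for t
      proof -
        have "M1 $$ (t, k0) = (\<Sum>k\<in>L. N $$ (t, k) * c k)"
          unfolding col[OF that] by (rule sum.mono_neutral_right) (use Ln in \<open>auto simp: c_def\<close>)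
        then show ?thesis by (simp add: w_def c_def)
      qed
      have w_low: "w t = N $$ (t, i)" if t: "p + m \<le> t" "t < ?n" for t
      proof (cases "t \<in> \<tau> ` L")
        case True
        then obtain k where k: "k \<in> L" "t = \<tau> k" by blast
        then show ?thesis unfolding w_def using left_end_combination(1)[OF CN t(2) k(1)] by simp
      next
        case False
        moreover have "t \<notin> \<rho> ` L" using t D(4) by force
        ultimately show ?thesis
          unfolding w_def using left_end_combination(2)[OF CN t(2)] neither(2) t by simp
      qed
      have w_\<rho>: "w (\<rho> k0) = N $$ (\<tau> k0, i)"
        unfolding w_def using left_end_combination(1)[OF CN \<rho>n k0] by simp
      have N_row: "N $$ (\<tau> k0, k) = 0" "N $$ (\<rho> k0, k) = 0" if "k < i" "k \<noteq> k0" for k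
      proof -
        have "\<not> (k \<in> L \<and> \<tau> k0 = \<tau> k)" using D(7) k0 that by (auto simp: inj_on_def)
        then show "N $$ (\<tau> k0, k) = 0" using D(9)[OF that(1) \<tau>n] \<tau>new that by auto
        have "\<rho> k0 \<noteq> \<rho> k" using D(2) k0i that by (auto simp: inj_on_def)
        moreover have "\<not> (k \<in> L \<and> \<rho> k0 = \<tau> k)" using D(4)[OF k0] D(5)[of k] by auto
        ultimately show "N $$ (\<rho> k0, k) = 0" using D(9)[OF that(1) \<rho>n] by auto
      qed
      have M1i: "M1 $$ (t, i) = N $$ (t, i)" if "t < ?n" for t
        using others[OF that i] k0i by simp
      have d1: "M1 $$ (\<tau> k0, i) \<noteq> 0" using M1i \<tau>n d by simp
      \<comment> \<open>The first pivot makes the new column the basis vector at \<open>\<tau> k0\<close>; the second one makes the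
          remaining part of column \<open>k0\<close> the basis vector at \<open>\<rho> k0\<close>.\<close>
      obtain M2 where M2: "M2 \<in> carrier (GL ?n)" "same_orbit p m q M1 M2"
        and e2: "\<And>t k. t < ?n \<Longrightarrow> k < ?n \<Longrightarrow> M2 $$ (t, k) =
          (if t = \<tau> k0 then M1 $$ (\<tau> k0, k) / M1 $$ (\<tau> k0, i)
           else if admissible p m t (\<tau> k0)
           then M1 $$ (t, k) - M1 $$ (t, i) / M1 $$ (\<tau> k0, i) * M1 $$ (\<tau> k0, k)
           else M1 $$ (t, k))"
        using pivot[OF M1(1) \<tau>n i d1] by blast
      have adm\<tau>: "admissible p m t (\<tau> k0) \<longleftrightarrow> p \<le> t" for t
        using D(5)[OF k0] by (auto simp: admissible_def)
      have M2_old: "M2 $$ (t, k) = N $$ (t, k)" if "t < ?n" "k < i" "k \<noteq> k0" for t k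
        using e2[of t k] others[of t k] others[of "\<tau> k0" k] N_row(1)[of k] that i \<tau>n by simp
      have M2_i: "M2 $$ (t, i) = (if t = \<tau> k0 then 1 else 0)" if "t < ?n" for t
        using e2[OF that i] d1 adm\<tau>[of t] M1i[OF that] neither(1)[of t] by auto
      have M2_k0: "M2 $$ (t, k0) = (if t = \<tau> k0 then 1 else if p + m \<le> t then 0
          else if p \<le> t then w t - N $$ (t, i) else w t)" if t: "t < ?n" for t
      proof -
        have "M1 $$ (\<tau> k0, k0) = N $$ (\<tau> k0, i)"
          using col'[OF \<tau>n] w_low[of "\<tau> k0"] D(5)[OF k0] \<tau>n by simp
        then show ?thesis
          using e2[of t k0] k0i i t M1i[OF t] M1i[OF \<tau>n] d col'[OF t] w_low[of t] adm\<tau>[of t]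
          by auto
      qed
      have \<rho>p: "\<rho> k0 < p" using D(4)[OF k0] .
      have \<rho>\<tau>: "\<rho> k0 \<noteq> \<tau> k0" using \<rho>p D(5)[OF k0] by simp
      have d2: "M2 $$ (\<rho> k0, k0) \<noteq> 0"
        using M2_k0[OF \<rho>n] \<rho>\<tau> \<rho>p w_\<rho> d by simp
      obtain M3 where M3: "M3 \<in> carrier (GL ?n)" "same_orbit p m q M2 M3"
        and e3: "\<And>t k. t < ?n \<Longrightarrow> k < ?n \<Longrightarrow> M3 $$ (t, k) =
          (if t = \<rho> k0 then M2 $$ (\<rho> k0, k) / M2 $$ (\<rho> k0, k0)
           else if admissible p m t (\<rho> k0)
           then M2 $$ (t, k) - M2 $$ (t, k0) / M2 $$ (\<rho> k0, k0) * M2 $$ (\<rho> k0, k)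
           else M2 $$ (t, k))"
        using pivot[OF M2(1) \<rho>n k0n d2] by blast
      have adm\<rho>: "admissible p m t (\<rho> k0) \<longleftrightarrow> t < p + m" for t
        using \<rho>p by (auto simp: admissible_def)
      have M3_old: "M3 $$ (t, k) = N $$ (t, k)" if "t < ?n" "k < i" for t k
      proof (cases "k = k0")
        case True
        then show ?thesis
          using e3[of t k0] that k0n d2 adm\<rho>[of t] M2_k0[OF that(1)] D(9)[of k0 t] D(5)[OF k0] k0 k0i by auto
      next
        case False
        then show ?thesis
          using e3[of t k] M2_old[of t k] M2_old[of "\<rho> k0" k] N_row(2)[of k] that i \<rho>n by simp
      qed
      have M3_i: "M3 $$ (t, i) = (if t = \<tau> k0 then 1 else 0)" if "t < ?n" for t
        using e3[OF that i] M2_i[OF that] M2_i[OF \<rho>n] \<rho>\<tau> by auto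
      have "clan_columns p m q i M3 \<rho> \<tau> L"
        by (rule clan_columns_cong[OF CN]) (use M3_old in auto)
      then have "clan_columns p m q (Suc i) M3 (\<rho>(i := \<tau> k0)) \<tau> L"
        using clan_columns_add_single M3_i \<tau>n \<tau>new by blast
      moreover have "same_orbit p m q N M3"
        using same_orbit_trans[OF N M1(2)] same_orbit_trans[OF M1(1) M2(2) M3(2)] by blast
      ultimately show ?thesis using trans[OF M3(1)] by blast
    qed
  qed
qed

lemma reduce_to_clan_columns:
  assumes M: "M \<in> carrier (GL (p + m + q))"
  shows "\<exists>M' \<rho> \<tau> L. M' \<in> carrier (GL (p + m + q)) \<and> same_orbit p m q M M' \<and>
    clan_columns p m q (p + m + q) M' \<rho> \<tau> L"
proof -
  have "\<exists>M' \<rho> \<tau> L. M' \<in> carrier (GL (p + m + q)) \<and> same_orbit p m q M M' \<and>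
    clan_columns p m q i M' \<rho> \<tau> L" if "i \<le> p + m + q" for i
    using that
  proof (induction i)
    case 0
    have "clan_columns p m q 0 M \<rho> \<tau> {}" for \<rho> \<tau> by (simp add: clan_columns_def)
    then show ?case using M same_orbit_refl[OF M] by blast
  next
    case (Suc i)
    then obtain M1 \<rho> \<tau> L where "M1 \<in> carrier (GL (p + m + q))" "same_orbit p m q M M1"
      "clan_columns p m q i M1 \<rho> \<tau> L" by (meson Suc_leD)
    moreover have "i < p + m + q" using Suc.prems by simp
    ultimately show ?case using reduce_next_column same_orbit_trans[OF M] by meson
  qed
  then show ?thesis by blast
qed

section \<open>The preclan of a matrix of clan shape\<close>

definition clan_of :: "nat \<Rightarrow> nat \<Rightarrow> nat \<Rightarrow> (nat \<Rightarrow> nat) \<Rightarrow> (nat \<Rightarrow> nat) \<Rightarrow> nat set \<Rightarrow> preclan" where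
  "clan_of p m q \<rho> \<tau> L =
    \<lparr>matching = {(Suc k, Suc j) | k j. k \<in> L \<and> j < p + m + q \<and> \<tau> k = \<rho> j},
     plus_nodes = Suc ` {k. k < p + m + q \<and> k \<notin> L \<and> \<rho> k < p},
     minus_nodes = Suc ` {j. j < p + m + q \<and> p + m \<le> \<rho> j \<and> \<rho> j \<notin> \<tau> ` L}\<rparr>"

lemma clan_columns_bij:
  assumes "clan_columns p m q (p + m + q) M \<rho> \<tau> L"
  shows "bij_betw \<rho> {..<p + m + q} {..<p + m + q}"
proof -
  note D = clan_columnsD[OF assms]
  have "\<rho> ` {..<p + m + q} \<subseteq> {..<p + m + q}" using D(3) by auto
  then show ?thesis using D(2) endo_inj_surj[of "{..<p + m + q}" \<rho>] by (simp add: bij_betw_def)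
qed

lemma clan_columns_row:
  assumes C: "clan_columns p m q (p + m + q) M \<rho> \<tau> L" and t: "t < p + m + q"
  obtains j where "j < p + m + q" "t = \<rho> j"
  using clan_columns_bij[OF C] t unfolding bij_betw_def by (metis imageE lessThan_iff)

text \<open>Since \<open>\<rho>\<close> is a bijection, the second row of every left-end is the leading row of exactly one
  column, and the block sizes \<open>p\<close>, \<open>m\<close>, \<open>q\<close> count the columns by the block of their leading row.\<close>

lemma clan_of_in_preclans:
  assumes C: "clan_columns p m q (p + m + q) M \<rho> \<tau> L"
  shows "clan_of p m q \<rho> \<tau> L \<in> preclans p m q"
proof -
  let ?n = "p + m + q"
  let ?\<gamma> = "clan_of p m q \<rho> \<tau> L"
  note D = clan_columnsD[OF C]
  note bij = clan_columns_bij[OF C]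
  have inj: "\<rho> j = \<rho> k \<longleftrightarrow> j = k" if "j < ?n" "k < ?n" for j k
    using D(2) that by (auto simp: inj_on_def)
  have inj\<tau>: "\<tau> j = \<tau> k \<longleftrightarrow> j = k" if "j \<in> L" "k \<in> L" for j k
    using D(7) that by (auto simp: inj_on_def)
  have fin: "finite L" using D(1) finite_subset by blast
  have Ln: "k < ?n" if "k \<in> L" for k using D(1) that by auto
  have card_\<rho>: "card {k. k < ?n \<and> \<rho> k \<in> A} = card A" if "A \<subseteq> {..<?n}" for A
  proof -
    have "A \<subseteq> \<rho> ` {k. k < ?n \<and> \<rho> k \<in> A}"
    proof
      fix t assume t: "t \<in> A"
      then obtain j where "j < ?n" "t = \<rho> j" using clan_columns_row[OF C, of t] \<open>A \<subseteq> {..<?n}\<close> by auto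
      then show "t \<in> \<rho> ` {k. k < ?n \<and> \<rho> k \<in> A}" using t by blast
    qed
    then have "\<rho> ` {k. k < ?n \<and> \<rho> k \<in> A} = A" by auto
    moreover have "inj_on \<rho> {k. k < ?n \<and> \<rho> k \<in> A}"
      using D(2) by (rule inj_on_subset) auto
    ultimately show ?thesis using card_image by metis
  qed
  define partner where "partner k = (SOME j. j < ?n \<and> \<rho> j = \<tau> k)" for k
  have partner: "partner k < ?n" "\<rho> (partner k) = \<tau> k" if "k \<in> L" for k
  proof -
    have "\<exists>j. j < ?n \<and> \<rho> j = \<tau> k" using clan_columns_row[OF C D(6)[OF that]] by metis
    then show "partner k < ?n" "\<rho> (partner k) = \<tau> k"
      unfolding partner_def by (metis (mono_tags, lifting) someI_ex)+
  qed
  have matching: "matching ?\<gamma> = (\<lambda>k. (Suc k, Suc (partner k))) ` L"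
    using partner inj by (auto simp: clan_of_def image_iff) metis
  have card_matching: "card (matching ?\<gamma>) = card L"
    unfolding matching by (rule card_image) (auto simp: inj_on_def)
  have left: "left_ends ?\<gamma> = Suc ` L"
    by (simp add: left_ends_def matching image_image)
  have right: "right_ends ?\<gamma> = Suc ` {j. j < ?n \<and> \<rho> j \<in> \<tau> ` L}"
    using partner inj unfolding right_ends_def matching image_image
    by (auto simp: image_iff) (metis partner inj)+
  have pm: "partial_matching ?n (matching ?\<gamma>)"
  proof -
    have 1: "k < partner k" if "k \<in> L" for k using D(8)[of k "partner k"] partner that by metis
    have 2: "partner k \<noteq> partner l" if "k \<in> L" "l \<in> L" "k \<noteq> l" for k l
      using partner inj\<tau> that by metis
    have 3: "partner k \<noteq> l" if "k \<in> L" "l \<in> L" for k l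
      using partner(2)[OF that(1)] D(4)[OF that(2)] D(5)[OF that(1)] by auto
    have disj: "{Suc k, Suc (partner k)} \<inter> {Suc l, Suc (partner l)} = {}"
      if "k \<in> L" "l \<in> L" "(Suc k, Suc (partner k)) \<noteq> (Suc l, Suc (partner l))" for k l
      using 2[of k l] 3[of k l] 3[of l k] that by auto
    show ?thesis unfolding partial_matching_def matching
    proof (intro conjI ballI)
      fix x assume "x \<in> (\<lambda>k. (Suc k, Suc (partner k))) ` L"
      then obtain k where "k \<in> L" "x = (Suc k, Suc (partner k))" by blast
      then show "case x of (i, j) \<Rightarrow> 1 \<le> i \<and> i < j \<and> j \<le> ?n"
        using 1[of k] partner(1)[of k] by simp
    next
      fix x assume "x \<in> (\<lambda>k. (Suc k, Suc (partner k))) ` L"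
      then obtain k where k: "k \<in> L" "x = (Suc k, Suc (partner k))" by blast
      show "case x of (i, j) \<Rightarrow> \<forall>(k, l)\<in>(\<lambda>k. (Suc k, Suc (partner k))) ` L.
          (i, j) \<noteq> (k, l) \<longrightarrow> {i, j} \<inter> {k, l} = {}"
        unfolding k(2) split_conv
      proof (rule ballI)
        fix y assume "y \<in> (\<lambda>k. (Suc k, Suc (partner k))) ` L"
        then obtain l where l: "l \<in> L" "y = (Suc l, Suc (partner l))" by blast
        show "case y of (i, j) \<Rightarrow> (Suc k, Suc (partner k)) \<noteq> (i, j) \<longrightarrow>
            {Suc k, Suc (partner k)} \<inter> {i, j} = {}"
          unfolding l(2) split_conv using disj[OF k(1) l(1)] by blast
      qed
    qed
  qed
  have plus: "plus_nodes ?\<gamma> = Suc ` {k. k < ?n \<and> k \<notin> L \<and> \<rho> k < p}"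
    and minus: "minus_nodes ?\<gamma> = Suc ` {j. j < ?n \<and> p + m \<le> \<rho> j \<and> \<rho> j \<notin> \<tau> ` L}"
    by (simp_all add: clan_of_def)
  have nodes: "{1..?n} = Suc ` {..<?n}"
    by (simp add: lessThan_atLeast0 atLeastLessThanSuc_atLeastAtMost)
  have \<tau>L: "\<rho> j \<notin> \<tau> ` L" if "\<rho> j < p + m" for j using D(5) that by fastforce
  have \<rho>L: "j \<notin> L" if "p \<le> \<rho> j" for j using D(4) that by fastforce
  have unmatched: "unmatched_nodes ?n ?\<gamma> = Suc ` {k. k < ?n \<and> k \<notin> L \<and> \<rho> k \<notin> \<tau> ` L}"
    unfolding unmatched_nodes_def left right nodes by auto
  have uncolored: "uncolored_nodes ?n ?\<gamma> = Suc ` {k. k < ?n \<and> \<rho> k \<in> {p..<p + m}}"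
  proof -
    have split: "{k. k < ?n \<and> k \<notin> L \<and> \<rho> k \<notin> \<tau> ` L} -
        ({k. k < ?n \<and> k \<notin> L \<and> \<rho> k < p} \<union> {j. j < ?n \<and> p + m \<le> \<rho> j \<and> \<rho> j \<notin> \<tau> ` L})
      = {k. k < ?n \<and> \<rho> k \<in> {p..<p + m}}" (is "?X - (?Y \<union> ?Z) = ?W")
    proof (rule Set.set_eqI)
      fix k
      show "k \<in> ?X - (?Y \<union> ?Z) \<longleftrightarrow> k \<in> ?W" using \<tau>L[of k] \<rho>L[of k] by auto
    qed
    have "Suc ` (?X - (?Y \<union> ?Z)) = Suc ` ?X - (Suc ` ?Y \<union> Suc ` ?Z)"
      unfolding image_set_diff[OF inj_Suc] image_Un ..
    then show ?thesis unfolding uncolored_nodes_def unmatched plus minus split by (rule sym)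
  qed
  have card_Suc: "card (Suc ` A) = card A" for A by (rule card_image) simp
  have "card {k. k < ?n \<and> k \<notin> L \<and> \<rho> k < p} + card L
      = card ({k. k < ?n \<and> k \<notin> L \<and> \<rho> k < p} \<union> L)"
    by (rule card_Un_disjoint[symmetric]) (use fin in auto)
  also have "{k. k < ?n \<and> k \<notin> L \<and> \<rho> k < p} \<union> L = {k. k < ?n \<and> \<rho> k \<in> {..<p}}"
    using Ln D(4) by auto
  also have "card \<dots> = p" using card_\<rho>[of "{..<p}"] by auto
  finally have cp: "card (plus_nodes ?\<gamma>) + card (matching ?\<gamma>) = p"
    unfolding plus card_matching card_Suc .
  have \<tau>sub: "\<tau> ` L \<subseteq> {p + m..<?n}" using D(5,6) by auto
  have card\<tau>: "card (\<tau> ` L) = card L" using D(7) by (rule card_image)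
  have "{j. j < ?n \<and> p + m \<le> \<rho> j \<and> \<rho> j \<notin> \<tau> ` L} = {j. j < ?n \<and> \<rho> j \<in> {p + m..<?n} - \<tau> ` L}"
    using D(3) by auto
  also have "card \<dots> = card ({p + m..<?n} - \<tau> ` L)" by (rule card_\<rho>) auto
  also have "\<dots> = q - card L" using \<tau>sub fin card\<tau> by (subst card_Diff_subset) auto
  finally have "card (minus_nodes ?\<gamma>) = q - card L" unfolding minus card_Suc .
  moreover have "card L \<le> q" using card_mono[OF _ \<tau>sub] card\<tau> by simp
  ultimately have cq: "card (minus_nodes ?\<gamma>) + card (matching ?\<gamma>) = q"
    unfolding card_matching by simp
  have cm: "card (uncolored_nodes ?n ?\<gamma>) = m"
    unfolding uncolored card_Suc by (subst card_\<rho>) auto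
  have "plus_nodes ?\<gamma> \<subseteq> unmatched_nodes ?n ?\<gamma>" unfolding plus unmatched using \<tau>L by auto
  moreover have "minus_nodes ?\<gamma> \<subseteq> unmatched_nodes ?n ?\<gamma>"
    unfolding minus unmatched using \<rho>L by auto
  moreover have "plus_nodes ?\<gamma> \<inter> minus_nodes ?\<gamma> = {}" unfolding plus minus by auto
  ultimately show ?thesis
    unfolding preclans_def Let_def using pm cp cq cm by blast
qed

text \<open>Row \<open>\<rho> j\<close> of the matrix has a 1 in column \<open>j\<close> and, if \<open>j\<close> is a right-end, another 1 in the
  column of its partner. Invertibility and the invariants of the flag are read off
  from these coordinates.\<close>

lemma clan_columns_mult_vec:
  assumes C: "clan_columns p m q (p + m + q) M \<rho> \<tau> L"
    and M: "M \<in> carrier_mat (p + m + q) (p + m + q)" and c: "c \<in> carrier_vec (p + m + q)"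
    and j: "j < p + m + q"
  shows "\<rho> j \<notin> \<tau> ` L \<Longrightarrow> (M *\<^sub>v c) $ \<rho> j = c $ j"
    and "k \<in> L \<Longrightarrow> \<tau> k = \<rho> j \<Longrightarrow> (M *\<^sub>v c) $ \<rho> j = c $ j + c $ k"
proof -
  let ?n = "p + m + q"
  note D = clan_columnsD[OF C]
  have entry: "M $$ (\<rho> j, l) = (if l = j \<or> l \<in> L \<and> \<tau> l = \<rho> j then 1 else 0)" if "l < ?n" for l
    using D(9)[OF that D(3)[OF j]] inj_on_eq_iff[OF D(2), of l j] that j by auto
  note product = mult_mat_vec_entry[OF M c D(3)[OF j]]
  show "(M *\<^sub>v c) $ \<rho> j = c $ j" if "\<rho> j \<notin> \<tau> ` L"
  proof -
    have "\<not> (l \<in> L \<and> \<tau> l = \<rho> j)" for l using that by (metis imageI)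
    then have "(M *\<^sub>v c) $ \<rho> j = (\<Sum>l<?n. if l = j then c $ l else 0)"
      unfolding product by (intro sum.cong) (use entry in auto)
    then show ?thesis using j by simp
  qed
  show "(M *\<^sub>v c) $ \<rho> j = c $ j + c $ k" if k: "k \<in> L" "\<tau> k = \<rho> j"
  proof -
    have kn: "k < ?n" using k D(1) by auto
    have kj: "k \<noteq> j" using D(4)[OF k(1)] D(5)[OF k(1)] k(2) by auto
    have "l \<in> L \<and> \<tau> l = \<rho> j \<longleftrightarrow> l = k" for l
      using k inj_on_eq_iff[OF D(7), of l k] by auto
    then have "(M *\<^sub>v c) $ \<rho> j = (\<Sum>l<?n. (if l = j then c $ l else 0) + (if l = k then c $ l else 0))"
      unfolding product by (intro sum.cong) (use entry kj in auto)
    then show ?thesis using j kn by (simp add: sum.distrib)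
  qed
qed

lemma clan_columns_GL:
  assumes C: "clan_columns p m q (p + m + q) M \<rho> \<tau> L"
    and M: "M \<in> carrier_mat (p + m + q) (p + m + q)"
  shows "M \<in> carrier (GL (p + m + q))"
proof -
  let ?n = "p + m + q"
  note D = clan_columnsD[OF C]
  have "v = 0\<^sub>v ?n" if v: "v \<in> carrier_vec ?n" and Mv: "M *\<^sub>v v = 0\<^sub>v ?n" for v
  proof -
    note row = clan_columns_mult_vec[OF C M v]
    have single: "v $ j = 0" if "j < ?n" "\<rho> j \<notin> \<tau> ` L" for j
      using row(1)[OF that] Mv D(3)[OF that(1)] by simp
    have "v $ j = 0" if j: "j < ?n" for j
    proof (cases "\<rho> j \<in> \<tau> ` L")
      case True
      then obtain k where k: "k \<in> L" "\<tau> k = \<rho> j" by auto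
      have "\<rho> k \<notin> \<tau> ` L" using D(4)[OF k(1)] D(5) by force
      then have "v $ k = 0" using single[of k] k(1) D(1) by auto
      then show ?thesis using row(2)[OF j k] Mv D(3)[OF j] by simp
    qed (use single j in blast)
    then show ?thesis using v by (intro eq_vecI) auto
  qed
  then have "det M \<noteq> 0" using det_0_iff_vec_prod_zero[OF M] by blast
  then show ?thesis using M by (simp add: GL_iff)
qed

section \<open>Invariants of flags\<close>

text \<open>The space of vectors whose coordinates in \<open>A\<close> vanish contains a vector of \<open>F\<^sub>i\<close> that is not in
  \<open>F\<^sub>i\<^sub>-\<^sub>1\<close>, where \<open>F\<^sub>i\<close> is spanned by the columns \<open>0, \<dots>, i\<close> of \<open>M\<close>. The vector is given by its
  coefficients \<open>c\<close> with respect to the columns of \<open>M\<close>, so that \<open>c $ i \<noteq> 0\<close> excludes \<open>F\<^sub>i\<^sub>-\<^sub>1\<close>.\<close>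

definition flag_meets :: "nat \<Rightarrow> complex mat \<Rightarrow> nat \<Rightarrow> nat set \<Rightarrow> bool" where
  "flag_meets n M i A \<longleftrightarrow> (\<exists>c \<in> carrier_vec n. c $ i \<noteq> 0 \<and> (\<forall>k<n. i < k \<longrightarrow> c $ k = 0) \<and>
     (\<forall>t\<in>A. (M *\<^sub>v c) $ t = 0))"

text \<open>Some vector of \<open>V\<^sub>2\<close> in \<open>F\<^sub>j\<close> outside \<open>F\<^sub>j\<^sub>-\<^sub>1\<close> is congruent modulo \<open>V\<^sub>1\<close> to a vector of \<open>F\<^sub>l\<close>.\<close>

definition flag_links :: "nat \<Rightarrow> nat \<Rightarrow> nat \<Rightarrow> complex mat \<Rightarrow> nat \<Rightarrow> nat \<Rightarrow> bool" where
  "flag_links p m q M l j \<longleftrightarrow> (\<exists>c \<in> carrier_vec (p + m + q). \<exists>d \<in> carrier_vec (p + m + q).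
     c $ j \<noteq> 0 \<and> (\<forall>k<p + m + q. j < k \<longrightarrow> c $ k = 0) \<and> (\<forall>t<p. (M *\<^sub>v c) $ t = 0) \<and>
     (\<forall>k<p + m + q. l < k \<longrightarrow> d $ k = 0) \<and>
     (\<forall>t\<in>{p + m..<p + m + q}. (M *\<^sub>v (c - d)) $ t = 0))"

text \<open>The preclan of a flag, described without a normal form. The predicates \<open>J1\<close>, \<open>J2\<close> and \<open>J0\<close> stand
  for \<open>V\<^sub>1\<close>, \<open>V\<^sub>2\<close> and \<open>V\<^sub>0\<close>, which are given by the vanishing of coordinates.\<close>

definition flag_clan :: "nat \<Rightarrow> nat \<Rightarrow> nat \<Rightarrow> complex mat \<Rightarrow> preclan" where
  "flag_clan p m q M = (let n = p + m + q;
       J1 = (\<lambda>i. flag_meets n M i {p + m..<n});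
       J2 = (\<lambda>i. flag_meets n M i {..<p});
       J0 = (\<lambda>i. flag_meets n M i ({..<p} \<union> {p + m..<n})) in
    \<lparr>matching = {(Suc k, Suc j) | k j. k < n \<and> j < n \<and> J1 j \<and> J2 j \<and> \<not> J0 j \<and>
        flag_links p m q M k j \<and> (\<forall>l<k. \<not> flag_links p m q M l j)},
     plus_nodes = Suc ` {k. k < n \<and> J1 k \<and> \<not> J2 k},
     minus_nodes = Suc ` {k. k < n \<and> J2 k \<and> \<not> J1 k}\<rparr>)"

lemma upper_tri_mult_vec:
  assumes b: "b \<in> upper_tri_subgroup n" and c: "c \<in> carrier_vec n"
    and zero: "\<And>k. k < n \<Longrightarrow> i < k \<Longrightarrow> c $ k = 0"
  shows "k < n \<Longrightarrow> i < k \<Longrightarrow> (b *\<^sub>v c) $ k = 0"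
    and "i < n \<Longrightarrow> c $ i \<noteq> 0 \<Longrightarrow> (b *\<^sub>v c) $ i \<noteq> 0"
proof -
  have bc: "b \<in> carrier_mat n n" and det: "det b \<noteq> 0" and ut: "upper_triangular b"
    using b by (auto simp: upper_tri_subgroup_def GL_iff)
  have low: "b $$ (r, l) = 0" if "r < n" "l < r" for r l
    using b that by (auto simp: upper_tri_subgroup_iff)
  show "(b *\<^sub>v c) $ k = 0" if "k < n" "i < k"
    unfolding mult_mat_vec_entry[OF bc c that(1)]
  proof (rule sum.neutral, rule ballI)
    fix l assume "l \<in> {..<n}"
    then show "b $$ (k, l) * c $ l = 0" using low[OF that(1), of l] zero[of l] that
      by (cases "l < k") auto
  qed
  show "(b *\<^sub>v c) $ i \<noteq> 0" if i: "i < n" "c $ i \<noteq> 0"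
  proof -
    have "(b *\<^sub>v c) $ i = (\<Sum>l<n. if l = i then b $$ (i, i) * c $ i else 0)"
      unfolding mult_mat_vec_entry[OF bc c i(1)]
    proof (rule sum.cong)
      fix l assume "l \<in> {..<n}"
      then show "b $$ (i, l) * c $ l = (if l = i then b $$ (i, i) * c $ i else 0)"
        using low[OF i(1), of l] zero[of l] by (cases l i rule: linorder_cases) auto
    qed simp
    then have "(b *\<^sub>v c) $ i = b $$ (i, i) * c $ i" using i by simp
    moreover have "b $$ (i, i) \<noteq> 0"
      using det bc i unfolding det_upper_triangular[OF ut bc] prod_list_diag_prod by auto
    ultimately show ?thesis using i by simp
  qed
qed

text \<open>The hypothesis on \<open>A\<close> says that the space of vectors whose coordinates in \<open>A\<close> vanish is stable
  under the block subgroup.\<close>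

lemma block_mult_vec_zero:
  assumes s: "s \<in> block_subgroup p m q" and x: "x \<in> carrier_vec (p + m + q)"
    and A: "A \<subseteq> {..<p + m + q}"
      "\<And>t r. t \<in> A \<Longrightarrow> r < p + m + q \<Longrightarrow> r \<notin> A \<Longrightarrow> \<not> admissible p m t r"
    and zero: "\<And>t. t \<in> A \<Longrightarrow> x $ t = 0" and t: "t \<in> A"
  shows "(s *\<^sub>v x) $ t = 0"
proof -
  have sc: "s \<in> carrier_mat (p + m + q) (p + m + q)" using s by (auto simp: block_subgroup_iff GL_iff)
  have tn: "t < p + m + q" using t A by auto
  show ?thesis unfolding mult_mat_vec_entry[OF sc x tn]
  proof (rule sum.neutral, rule ballI)
    fix k assume k: "k \<in> {..<p + m + q}"
    show "s $$ (t, k) * x $ k = 0"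
      using s A(2)[OF t] zero[of k] k tn by (cases "k \<in> A") (auto simp: block_subgroup_iff)
  qed
qed

text \<open>The coefficient vector of a vector of the flag is transformed by \<open>b\<close>, which preserves the last
  nonzero position, and the vector itself by \<open>s\<close>, which preserves \<open>V\<^sub>1\<close> and \<open>V\<^sub>2\<close>. Therefore the
  invariants of the flag are constant on orbits.\<close>

lemma same_orbit_commute:
  assumes "same_orbit p m q M M'" and M: "M \<in> carrier (GL (p + m + q))"
  obtains s b where "s \<in> block_subgroup p m q" "b \<in> upper_tri_subgroup (p + m + q)"
    "\<And>c. c \<in> carrier_vec (p + m + q) \<Longrightarrow> M' *\<^sub>v (b *\<^sub>v c) = s *\<^sub>v (M *\<^sub>v c)"
proof -
  let ?n = "p + m + q"
  interpret group "GL ?n" by (rule group_GL)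
  obtain s b where s: "s \<in> block_subgroup p m q" and b: "b \<in> upper_tri_subgroup ?n"
    and eq: "M' = s * M * b"
    using assms(1) unfolding same_orbit_def by blast
  let ?b = "inv\<^bsub>GL ?n\<^esub> b"
  have bG: "b \<in> carrier (GL ?n)" and sG: "s \<in> carrier (GL ?n)"
    using b s by (auto simp: upper_tri_subgroup_iff block_subgroup_iff)
  have b': "?b \<in> upper_tri_subgroup ?n"
    using subgroup.m_inv_closed[OF subgroup_upper_tri b] .
  have c: "s \<in> carrier_mat ?n ?n" "M \<in> carrier_mat ?n ?n" "b \<in> carrier_mat ?n ?n"
    "?b \<in> carrier_mat ?n ?n"
    using bG sG M inv_closed[OF bG] by (auto simp: GL_iff)
  have "M' * ?b = s * M * (b * ?b)"
    unfolding eq by (rule assoc_mult_mat) (use c in auto)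
  also have "\<dots> = s * M" using r_inv[OF bG] c by simp
  finally have eq': "M' * ?b = s * M" .
  have M'c: "M' \<in> carrier_mat ?n ?n" using c eq by simp
  have "M' *\<^sub>v (?b *\<^sub>v v) = s *\<^sub>v (M *\<^sub>v v)" if v: "v \<in> carrier_vec ?n" for v
    using assoc_mult_mat_vec[OF M'c c(4) v] assoc_mult_mat_vec[OF c(1,2) v] eq' by simp
  then show ?thesis using that s b' by blast
qed

lemma flag_meets_invariant:
  assumes same: "same_orbit p m q M M'" and M: "M \<in> carrier (GL (p + m + q))"
    and A: "A \<subseteq> {..<p + m + q}"
      "\<And>t r. t \<in> A \<Longrightarrow> r < p + m + q \<Longrightarrow> r \<notin> A \<Longrightarrow> \<not> admissible p m t r"
    and i: "i < p + m + q" and meets: "flag_meets (p + m + q) M i A"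
  shows "flag_meets (p + m + q) M' i A"
proof -
  let ?n = "p + m + q"
  obtain s b where s: "s \<in> block_subgroup p m q" and b: "b \<in> upper_tri_subgroup ?n"
    and eq: "\<And>c. c \<in> carrier_vec ?n \<Longrightarrow> M' *\<^sub>v (b *\<^sub>v c) = s *\<^sub>v (M *\<^sub>v c)"
    using same_orbit_commute[OF same M] by blast
  obtain c where c: "c \<in> carrier_vec ?n" "c $ i \<noteq> 0" "\<And>k. k < ?n \<Longrightarrow> i < k \<Longrightarrow> c $ k = 0"
    "\<And>t. t \<in> A \<Longrightarrow> (M *\<^sub>v c) $ t = 0"
    using meets unfolding flag_meets_def by blast
  have car: "b *\<^sub>v c \<in> carrier_vec ?n" "M *\<^sub>v c \<in> carrier_vec ?n"
    using b M c(1) by (auto simp: upper_tri_subgroup_iff GL_iff)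
  have "(M' *\<^sub>v (b *\<^sub>v c)) $ t = 0" if "t \<in> A" for t
    unfolding eq[OF c(1)] using block_mult_vec_zero[OF s car(2) A c(4) that] .
  then show ?thesis unfolding flag_meets_def
    using car(1) upper_tri_mult_vec[OF b c(1) c(3)] i c(2) by blast
qed

lemma flag_links_invariant:
  assumes same: "same_orbit p m q M M'" and M: "M \<in> carrier (GL (p + m + q))"
    and j: "j < p + m + q" and links: "flag_links p m q M l j"
  shows "flag_links p m q M' l j"
proof -
  let ?n = "p + m + q"
  obtain s b where s: "s \<in> block_subgroup p m q" and b: "b \<in> upper_tri_subgroup ?n"
    and eq: "\<And>c. c \<in> carrier_vec ?n \<Longrightarrow> M' *\<^sub>v (b *\<^sub>v c) = s *\<^sub>v (M *\<^sub>v c)"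
    using same_orbit_commute[OF same M] by blast
  obtain c d where c: "c \<in> carrier_vec ?n" "c $ j \<noteq> 0" "\<And>k. k < ?n \<Longrightarrow> j < k \<Longrightarrow> c $ k = 0"
    "\<And>t. t < p \<Longrightarrow> (M *\<^sub>v c) $ t = 0"
    and d: "d \<in> carrier_vec ?n" "\<And>k. k < ?n \<Longrightarrow> l < k \<Longrightarrow> d $ k = 0"
    and cd: "\<And>t. t \<in> {p + m..<?n} \<Longrightarrow> (M *\<^sub>v (c - d)) $ t = 0"
    using links unfolding flag_links_def by blast
  have bc: "b \<in> carrier_mat ?n ?n" and Mc: "M \<in> carrier_mat ?n ?n"
    using b M by (auto simp: upper_tri_subgroup_iff GL_iff)
  have cdc: "c - d \<in> carrier_vec ?n" using c(1) d(1) by simp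
  have car: "b *\<^sub>v c \<in> carrier_vec ?n" "b *\<^sub>v d \<in> carrier_vec ?n" "M *\<^sub>v c \<in> carrier_vec ?n"
    "M *\<^sub>v (c - d) \<in> carrier_vec ?n"
    using bc Mc c(1) d(1) cdc by auto
  have 1: "(M' *\<^sub>v (b *\<^sub>v c)) $ t = 0" if "t < p" for t
    unfolding eq[OF c(1)]
    by (rule block_mult_vec_zero[OF s car(3), of "{..<p}"]) (use c(4) that in \<open>auto simp: admissible_def\<close>)
  have 2: "(M' *\<^sub>v (b *\<^sub>v c - b *\<^sub>v d)) $ t = 0" if t: "t \<in> {p + m..<?n}" for t
  proof -
    have "b *\<^sub>v c - b *\<^sub>v d = b *\<^sub>v (c - d)"
      using mult_minus_distrib_mat_vec[OF bc c(1) d(1)] by simp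
    then show ?thesis
      using block_mult_vec_zero[OF s car(4), of "{p + m..<?n}" t] cd t eq[OF cdc]
      by (simp add: admissible_def subset_eq)
  qed
  have 3: "(b *\<^sub>v c) $ j \<noteq> 0" using upper_tri_mult_vec(2)[OF b c(1) c(3) j c(2)] .
  have 4: "(b *\<^sub>v c) $ k = 0" if "k < ?n" "j < k" for k
    using upper_tri_mult_vec(1)[OF b c(1) c(3) that] .
  have 5: "(b *\<^sub>v d) $ k = 0" if "k < ?n" "l < k" for k
    using upper_tri_mult_vec(1)[OF b d(1) d(2) that] .
  show ?thesis unfolding flag_links_def
    using car(1,2) 1 2 3 4 5 by blast
qed

lemma flag_clan_invariant:
  assumes same: "same_orbit p m q M M'" and M: "M \<in> carrier (GL (p + m + q))"
    and M': "M' \<in> carrier (GL (p + m + q))"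
  shows "flag_clan p m q M = flag_clan p m q M'"
proof -
  let ?n = "p + m + q"
  have same': "same_orbit p m q M' M" using same_orbit_sym[OF M same] .
  have meets: "flag_meets ?n M i A \<longleftrightarrow> flag_meets ?n M' i A"
    if "A \<subseteq> {..<?n}" "\<And>t r. t \<in> A \<Longrightarrow> r < ?n \<Longrightarrow> r \<notin> A \<Longrightarrow> \<not> admissible p m t r" "i < ?n" for i A
    using flag_meets_invariant[OF same M that] flag_meets_invariant[OF same' M' that] by blast
  have J1: "flag_meets ?n M i {p + m..<?n} \<longleftrightarrow> flag_meets ?n M' i {p + m..<?n}" if "i < ?n" for i
    by (rule meets) (use that in \<open>auto simp: admissible_def\<close>)
  have J2: "flag_meets ?n M i {..<p} \<longleftrightarrow> flag_meets ?n M' i {..<p}" if "i < ?n" for i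
    by (rule meets) (use that in \<open>auto simp: admissible_def\<close>)
  have J0: "flag_meets ?n M i ({..<p} \<union> {p + m..<?n}) \<longleftrightarrow>
      flag_meets ?n M' i ({..<p} \<union> {p + m..<?n})" if "i < ?n" for i
    by (rule meets) (use that in \<open>auto simp: admissible_def\<close>)
  have links: "flag_links p m q M l j \<longleftrightarrow> flag_links p m q M' l j" if "j < ?n" for l j
    using flag_links_invariant[OF same M that] flag_links_invariant[OF same' M' that] by blast
  show ?thesis
    unfolding flag_clan_def Let_def
    by (intro preclan.equality; simp; intro Collect_cong arg_cong[where f = "\<lambda>X. Suc ` X"] ex_cong1)
      (use J1 J2 J0 links in \<open>auto cong: conj_cong\<close>)
qed

text \<open>For each kind of node, a column or a difference of two matched columns is the required vector.
  Conversely, the coordinates in suitable rows (the leading rows of the node and of its partner, or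
  the second row of a left-end) force the last coefficient to vanish.\<close>

lemma flag_clan_eq_clan_of:
  assumes C: "clan_columns p m q (p + m + q) M \<rho> \<tau> L"
    and M: "M \<in> carrier_mat (p + m + q) (p + m + q)"
  shows "flag_clan p m q M = clan_of p m q \<rho> \<tau> L"
proof -
  let ?n = "p + m + q"
  note D = clan_columnsD[OF C]
  note row = clan_columns_mult_vec[OF C M]
  have Ln: "k < ?n" if "k \<in> L" for k using D(1) that by auto
  have unit: "(M *\<^sub>v unit_vec ?n k) $ t = M $$ (t, k)" if "k < ?n" "t < ?n" for k t
    using M that by simp
  have \<tau>L: "\<rho> j \<notin> \<tau> ` L" if "\<rho> j < p + m" for j using D(5) that by fastforce
  have \<rho>L: "j \<notin> L" if "p \<le> \<rho> j" for j using D(4) that by fastforce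
  have meets_unit: "flag_meets ?n M i A"
    if "i < ?n" "A \<subseteq> {..<?n}" "\<And>t. t \<in> A \<Longrightarrow> M $$ (t, i) = 0" for i A
    unfolding flag_meets_def
    by (rule bexI[of _ "unit_vec ?n i"]) (use that unit in \<open>auto simp: subset_eq\<close>)
  have J2: "flag_meets ?n M i {..<p} \<longleftrightarrow> p \<le> \<rho> i" if i: "i < ?n" for i
  proof
    assume "flag_meets ?n M i {..<p}"
    then obtain c where c: "c \<in> carrier_vec ?n" "c $ i \<noteq> 0" "\<And>t. t < p \<Longrightarrow> (M *\<^sub>v c) $ t = 0"
      unfolding flag_meets_def by blast
    then show "p \<le> \<rho> i" using row(1)[OF c(1) i] \<tau>L[of i] by fastforce
  next
    assume "p \<le> \<rho> i"
    then show "flag_meets ?n M i {..<p}"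
      by (intro meets_unit[OF i]) (use D(9)[OF i] \<rho>L[of i] in auto)
  qed
  have J1: "flag_meets ?n M i {p + m..<?n} \<longleftrightarrow> \<rho> i < p + m \<and> i \<notin> L \<or> \<rho> i \<in> \<tau> ` L"
    if i: "i < ?n" for i
  proof
    assume "flag_meets ?n M i {p + m..<?n}"
    then obtain c where c: "c \<in> carrier_vec ?n" "c $ i \<noteq> 0" "\<And>k. k < ?n \<Longrightarrow> i < k \<Longrightarrow> c $ k = 0"
      "\<And>t. p + m \<le> t \<Longrightarrow> t < ?n \<Longrightarrow> (M *\<^sub>v c) $ t = 0"
      unfolding flag_meets_def by fastforce
    show "\<rho> i < p + m \<and> i \<notin> L \<or> \<rho> i \<in> \<tau> ` L"
    proof (rule ccontr)
      assume neg: "\<not> ?thesis"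
      show False
      proof (cases "i \<in> L")
        case True
        obtain j where j: "j < ?n" "\<tau> i = \<rho> j" using clan_columns_row[OF C D(6)[OF True]] .
        have "i < j" using D(8)[OF True j] .
        then have "(M *\<^sub>v c) $ \<rho> j = c $ i" using row(2)[OF c(1) j(1) True j(2)] c(3) j(1) by simp
        then show False using c(2) c(4)[of "\<rho> j"] D(5)[OF True] D(6)[OF True] j(2) by simp
      next
        case False
        then show False using neg row(1)[OF c(1) i] c(2) c(4)[OF _ D(3)[OF i]] by simp
      qed
    qed
  next
    assume "\<rho> i < p + m \<and> i \<notin> L \<or> \<rho> i \<in> \<tau> ` L"
    then show "flag_meets ?n M i {p + m..<?n}"
    proof
      assume "\<rho> i < p + m \<and> i \<notin> L"
      then show ?thesis by (intro meets_unit[OF i]) (use D(9)[OF i] in auto)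
    next
      assume "\<rho> i \<in> \<tau> ` L"
      then obtain k where k: "k \<in> L" "\<tau> k = \<rho> i" by auto
      have ki: "k < i" using D(8)[OF k(1) i k(2)] .
      have iL: "i \<notin> L" using \<rho>L[of i] D(5)[OF k(1)] k(2) by simp
      let ?c = "unit_vec ?n k - unit_vec ?n i :: complex vec"
      have "(M *\<^sub>v ?c) $ t = 0" if t: "p + m \<le> t" "t < ?n" for t
      proof -
        have "(M *\<^sub>v ?c) $ t = M $$ (t, k) - M $$ (t, i)"
          using M t Ln[OF k(1)] i
          by (subst mult_minus_distrib_mat_vec[of _ ?n ?n]) (simp_all add: unit)
        then show ?thesis
          using D(9)[OF Ln[OF k(1)] t(2)] D(9)[OF i t(2)] k iL D(4)[OF k(1)] t by auto
      qed
      then show ?thesis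
        unfolding flag_meets_def using ki i by (intro bexI[of _ ?c]) auto
    qed
  qed
  have J0: "flag_meets ?n M i ({..<p} \<union> {p + m..<?n}) \<longleftrightarrow> p \<le> \<rho> i \<and> \<rho> i < p + m"
    if i: "i < ?n" for i
  proof
    assume "flag_meets ?n M i ({..<p} \<union> {p + m..<?n})"
    then obtain c where c: "c \<in> carrier_vec ?n" "c $ i \<noteq> 0"
      "\<And>t. t < p \<Longrightarrow> (M *\<^sub>v c) $ t = 0" "\<And>t. p + m \<le> t \<Longrightarrow> t < ?n \<Longrightarrow> (M *\<^sub>v c) $ t = 0"
      unfolding flag_meets_def by fastforce
    show "p \<le> \<rho> i \<and> \<rho> i < p + m"
    proof (rule ccontr)
      assume "\<not> ?thesis"
      then have zero: "(M *\<^sub>v c) $ \<rho> i = 0" using c(3,4) D(3)[OF i] by force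
      show False
      proof (cases "\<rho> i \<in> \<tau> ` L")
        case True
        then obtain k where k: "k \<in> L" "\<tau> k = \<rho> i" by auto
        have "c $ k = 0"
          using row(1)[OF c(1) Ln[OF k(1)]] \<tau>L[of k] D(4)[OF k(1)] c(3) by force
        then show False using row(2)[OF c(1) i k] zero c(2) by simp
      next
        case False
        then show False using row(1)[OF c(1) i] zero c(2) by simp
      qed
    qed
  next
    assume "p \<le> \<rho> i \<and> \<rho> i < p + m"
    then show "flag_meets ?n M i ({..<p} \<union> {p + m..<?n})"
      by (intro meets_unit[OF i]) (use D(9)[OF i] \<rho>L[of i] in auto)
  qed
  have links: "flag_links p m q M l j \<longleftrightarrow> k \<le> l" if k: "k \<in> L" and j: "j < ?n" "\<tau> k = \<rho> j" for l j k
  proof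
    have kj: "k < j" using D(8)[OF k j] .
    assume "flag_links p m q M l j"
    then obtain c d where c: "c \<in> carrier_vec ?n" "c $ j \<noteq> 0" "\<And>t. t < p \<Longrightarrow> (M *\<^sub>v c) $ t = 0"
      and d: "d \<in> carrier_vec ?n" "\<And>k. k < ?n \<Longrightarrow> l < k \<Longrightarrow> d $ k = 0"
      and cd: "\<And>t. t \<in> {p + m..<?n} \<Longrightarrow> (M *\<^sub>v (c - d)) $ t = 0"
      unfolding flag_links_def by blast
    show "k \<le> l"
    proof (rule ccontr)
      assume "\<not> k \<le> l"
      then have dz: "d $ k = 0" "d $ j = 0" using d(2) kj j Ln[OF k] by auto
      have ck: "c $ k = 0"
        using row(1)[OF c(1) Ln[OF k]] \<tau>L[of k] D(4)[OF k] c(3) by force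
      have "(M *\<^sub>v (c - d)) $ \<rho> j = (c - d) $ j + (c - d) $ k"
        using row(2)[OF _ j(1) k j(2), of "c - d"] c(1) d(1) by simp
      also have "\<dots> = c $ j" using c(1) d(1) j(1) Ln[OF k] dz ck by simp
      finally show False using cd[of "\<rho> j"] D(5)[OF k] D(6)[OF k] j(2) c(2) by simp
    qed
  next
    assume kl: "k \<le> l"
    have kn: "k < ?n" using Ln[OF k] .
    have jL: "j \<notin> L" using \<rho>L[of j] D(5)[OF k] j(2) by simp
    have 1: "(M *\<^sub>v unit_vec ?n j) $ t = 0" if "t < p" for t
      using unit[OF j(1), of t] D(9)[OF j(1), of t] that jL D(5)[OF k] j(2) by auto
    have 2: "(M *\<^sub>v (unit_vec ?n j - unit_vec ?n k)) $ t = 0" if t: "t \<in> {p + m..<?n}" for t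
    proof -
      have "(M *\<^sub>v (unit_vec ?n j - unit_vec ?n k)) $ t = M $$ (t, j) - M $$ (t, k)"
        using M t kn j by (subst mult_minus_distrib_mat_vec[of _ ?n ?n]) (simp_all add: unit)
      then show ?thesis
        using D(9)[OF kn, of t] D(9)[OF j(1), of t] t k j jL D(4)[OF k] by auto
    qed
    show "flag_links p m q M l j"
      unfolding flag_links_def
      by (rule bexI[of _ "unit_vec ?n j"], rule bexI[of _ "unit_vec ?n k"])
        (use 1 2 kl j kn in auto)
  qed
  have right: "flag_meets ?n M j {p + m..<?n} \<and> flag_meets ?n M j {..<p} \<and>
      \<not> flag_meets ?n M j ({..<p} \<union> {p + m..<?n}) \<longleftrightarrow> \<rho> j \<in> \<tau> ` L" if j: "j < ?n" for j
    using J1[OF j] J2[OF j] J0[OF j] D(5) \<rho>L[of j] by fastforce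
  have matched: "k < ?n \<and> j < ?n \<and> flag_meets ?n M j {p + m..<?n} \<and> flag_meets ?n M j {..<p} \<and>
      \<not> flag_meets ?n M j ({..<p} \<union> {p + m..<?n}) \<and>
      flag_links p m q M k j \<and> (\<forall>l<k. \<not> flag_links p m q M l j) \<longleftrightarrow>
      k \<in> L \<and> j < ?n \<and> \<tau> k = \<rho> j" (is "?l k j \<longleftrightarrow> ?r k j") for k j
  proof
    assume l: "?l k j"
    then obtain k' where k': "k' \<in> L" "\<tau> k' = \<rho> j" using right[of j] by auto
    have "flag_links p m q M l j \<longleftrightarrow> k' \<le> l" for l using links[OF k'(1) _ k'(2)] l by blast
    then have "k' = k" using l by (metis le_less_linear order_refl le_antisym)
    then show "?r k j" using k' l by blast
  next
    assume r: "?r k j"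
    then have "flag_links p m q M l j \<longleftrightarrow> k \<le> l" for l using links[of k j l] by blast
    moreover have "\<rho> j \<in> \<tau> ` L" using r by (metis imageI)
    ultimately show "?l k j" using r right[of j] Ln[of k] by auto
  qed
  have plus: "k < ?n \<and> flag_meets ?n M k {p + m..<?n} \<and> \<not> flag_meets ?n M k {..<p} \<longleftrightarrow>
      k < ?n \<and> k \<notin> L \<and> \<rho> k < p" for k
    using J1[of k] J2[of k] \<tau>L[of k] by auto
  have minus: "k < ?n \<and> flag_meets ?n M k {..<p} \<and> \<not> flag_meets ?n M k {p + m..<?n} \<longleftrightarrow>
      k < ?n \<and> p + m \<le> \<rho> k \<and> \<rho> k \<notin> \<tau> ` L" for k
    using J1[of k] J2[of k] \<tau>L[of k] \<rho>L[of k] by auto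
  show ?thesis unfolding flag_clan_def clan_of_def Let_def matched plus minus ..
qed

section \<open>The matrices of preclans\<close>

lemma rank_in_bounds:
  assumes "finite A" "i \<in> A"
  shows "1 \<le> rank_in A i" "rank_in A i \<le> card A"
proof -
  have "i \<in> {k \<in> A. k \<le> i}" "finite {k \<in> A. k \<le> i}" using assms by auto
  then have "card {k \<in> A. k \<le> i} > 0" by (auto simp: card_gt_0_iff)
  then show "1 \<le> rank_in A i" by (simp add: rank_in_def)
  show "rank_in A i \<le> card A" unfolding rank_in_def by (rule card_mono) (use assms in auto)
qed

lemma rank_in_inj:
  assumes "finite A" "i \<in> A" "j \<in> A" "rank_in A i = rank_in A j"
  shows "i = j"
proof -
  have less: "rank_in A i < rank_in A j" if "i < j" "j \<in> A" for i j
  proof -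
    have "{k \<in> A. k \<le> i} \<subseteq> {k \<in> A. k \<le> j}" "j \<in> {k \<in> A. k \<le> j}" "j \<notin> {k \<in> A. k \<le> i}"
      using that by auto
    then have "{k \<in> A. k \<le> i} \<subset> {k \<in> A. k \<le> j}" by blast
    then show ?thesis unfolding rank_in_def by (rule psubset_card_mono[rotated]) (use assms(1) in auto)
  qed
  show ?thesis
    using less[of i j] less[of j i] assms by (cases i j rule: linorder_cases) auto
qed

lemma partial_matchingD:
  assumes "partial_matching n M" "(i, j) \<in> M"
  shows "1 \<le> i" "i < j" "j \<le> n"
    and "(k, l) \<in> M \<Longrightarrow> i = k \<Longrightarrow> j = l" "(k, l) \<in> M \<Longrightarrow> j = l \<Longrightarrow> i = k"
    and "(k, l) \<in> M \<Longrightarrow> i \<noteq> l"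
proof -
  show ij: "1 \<le> i" "i < j" "j \<le> n" using assms unfolding partial_matching_def by auto
  have disj: "{i, j} \<inter> {k, l} = {}" if "(k, l) \<in> M" "(i, j) \<noteq> (k, l)" for k l
    using assms that unfolding partial_matching_def by (metis (mono_tags, lifting) case_prodD)
  show "(k, l) \<in> M \<Longrightarrow> i = k \<Longrightarrow> j = l" "(k, l) \<in> M \<Longrightarrow> j = l \<Longrightarrow> i = k"
    using disj[of k l] by auto
  show "(k, l) \<in> M \<Longrightarrow> i \<noteq> l" using disj[of k l] ij by auto
qed

lemma partial_matching_finite:
  assumes "partial_matching n M"
  shows "finite M"
proof -
  have "M \<subseteq> {..n} \<times> {..n}" using partial_matchingD[OF assms] by fastforce
  then show ?thesis by (rule finite_subset) simp
qed

text \<open>The leading row of node \<open>i\<close> is \<open>\<sigma>(i) - 1\<close>, and the second row of a left-end is the leading row of its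
  partner. The permutation \<open>\<sigma>\<close> sends plus nodes and left-ends to the first block, uncolored nodes to
  the second, and minus nodes and right-ends to the third.\<close>

lemma preclan_mat_clan_columns:
  assumes \<gamma>: "\<gamma> \<in> preclans p m q"
  shows "\<exists>\<rho> \<tau> L. clan_columns p m q (p + m + q) (preclan_mat p m q \<gamma>) \<rho> \<tau> L \<and>
    clan_of p m q \<rho> \<tau> L = \<gamma>"
proof -
  let ?n = "p + m + q"
  let ?\<sigma> = "preclan_perm p m q \<gamma>"
  define A where "A = plus_nodes \<gamma> \<union> left_ends \<gamma>"
  define U where "U = uncolored_nodes ?n \<gamma>"
  define D where "D = minus_nodes \<gamma> \<union> right_ends \<gamma>"
  have pm: "partial_matching ?n (matching \<gamma>)"
    and plus: "plus_nodes \<gamma> \<subseteq> unmatched_nodes ?n \<gamma>"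
    and minus: "minus_nodes \<gamma> \<subseteq> unmatched_nodes ?n \<gamma>"
    and pmdisj: "plus_nodes \<gamma> \<inter> minus_nodes \<gamma> = {}"
    and cp: "card (plus_nodes \<gamma>) + card (matching \<gamma>) = p"
    and cq: "card (minus_nodes \<gamma>) + card (matching \<gamma>) = q"
    and cm: "card U = m"
    using \<gamma> by (auto simp: preclans_def Let_def U_def)
  note P = partial_matchingD[OF pm]
  have finM: "finite (matching \<gamma>)" using partial_matching_finite[OF pm] .
  have left_sub: "left_ends \<gamma> \<subseteq> {1..?n}" using P by (fastforce simp: left_ends_def)
  have right_sub: "right_ends \<gamma> \<subseteq> {1..?n}" using P by (fastforce simp: right_ends_def)
  have lr: "left_ends \<gamma> \<inter> right_ends \<gamma> = {}"
    using P(6) by (fastforce simp: left_ends_def right_ends_def)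
  have un: "unmatched_nodes ?n \<gamma> = {1..?n} - (left_ends \<gamma> \<union> right_ends \<gamma>)"
    by (simp add: unmatched_nodes_def)
  have AU: "A \<inter> U = {}" and AD: "A \<inter> D = {}" and UD: "U \<inter> D = {}"
    and AUD: "A \<union> U \<union> D = {1..?n}"
    using plus minus pmdisj left_sub right_sub lr
    unfolding A_def U_def D_def uncolored_nodes_def un by blast+
  have fin: "finite A" "finite U" "finite D"
    using AUD by (metis finite_Un finite_atLeastAtMost)+
  have inj_left: "inj_on fst (matching \<gamma>)"
    using P(4) by (fastforce simp: inj_on_def)
  have inj_right: "inj_on snd (matching \<gamma>)"
    using P(5) by (fastforce simp: inj_on_def)
  have cA: "card A = p"
  proof -
    have "card A = card (plus_nodes \<gamma>) + card (left_ends \<gamma>)"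
      unfolding A_def by (rule card_Un_disjoint) (use fin plus un in \<open>auto simp: A_def\<close>)
    then show ?thesis using cp card_image[OF inj_left] by (simp add: left_ends_def)
  qed
  have cD: "card D = q"
  proof -
    have "card D = card (minus_nodes \<gamma>) + card (right_ends \<gamma>)"
      unfolding D_def by (rule card_Un_disjoint) (use fin minus un in \<open>auto simp: D_def\<close>)
    then show ?thesis using cq card_image[OF inj_right] by (simp add: right_ends_def)
  qed
  have sA: "?\<sigma> i = rank_in A i" if "i \<in> A" for i
    using that by (simp add: preclan_perm_def A_def)
  have sU: "?\<sigma> i = p + rank_in U i" if "i \<in> U" for i
    using that AU unfolding preclan_perm_def A_def[symmetric] U_def[symmetric] by auto
  have sD: "?\<sigma> i = p + m + rank_in D i" if "i \<in> D" for i
    using that AD UD unfolding preclan_perm_def A_def[symmetric] U_def[symmetric] D_def[symmetric]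
    by auto
  have bA: "1 \<le> ?\<sigma> i \<and> ?\<sigma> i \<le> p" if "i \<in> A" for i
    using rank_in_bounds[OF fin(1) that] sA[OF that] cA by simp
  have bU: "p < ?\<sigma> i \<and> ?\<sigma> i \<le> p + m" if "i \<in> U" for i
    using rank_in_bounds[OF fin(2) that] sU[OF that] cm by simp
  have bD: "p + m < ?\<sigma> i \<and> ?\<sigma> i \<le> ?n" if "i \<in> D" for i
    using rank_in_bounds[OF fin(3) that] sD[OF that] cD by simp
  have node: "i \<in> A \<or> i \<in> U \<or> i \<in> D" if "1 \<le> i" "i \<le> ?n" for i
    using AUD that by (metis UnE atLeastAtMost_iff)
  have bound: "1 \<le> ?\<sigma> i \<and> ?\<sigma> i \<le> ?n" if "1 \<le> i" "i \<le> ?n" for i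
    using node[OF that] bA[of i] bU[of i] bD[of i] by linarith
  have inj: "i = j" if ij: "1 \<le> i" "i \<le> ?n" "1 \<le> j" "j \<le> ?n" and eq: "?\<sigma> i = ?\<sigma> j" for i j
  proof -
    consider "i \<in> A" "j \<in> A" | "i \<in> U" "j \<in> U" | "i \<in> D" "j \<in> D"
      using node[OF ij(1,2)] node[OF ij(3,4)] bA[of i] bU[of i] bD[of i] bA[of j] bU[of j] bD[of j] eq
      by linarith
    then show ?thesis
      by cases (use eq sA sU sD rank_in_inj[OF fin(1)] rank_in_inj[OF fin(2)] rank_in_inj[OF fin(3)]
        in auto)
  qed
  have inA: "?\<sigma> i \<le> p \<longleftrightarrow> i \<in> A" if "1 \<le> i" "i \<le> ?n" for i
    using node[OF that] bA[of i] bU[of i] bD[of i] by linarith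
  have inD: "p + m < ?\<sigma> i \<longleftrightarrow> i \<in> D" if "1 \<le> i" "i \<le> ?n" for i
    using node[OF that] bA[of i] bU[of i] bD[of i] by linarith

  define partner where "partner i = (THE j. (i, j) \<in> matching \<gamma>)" for i
  have partner: "partner i = j" if "(i, j) \<in> matching \<gamma>" for i j
    unfolding partner_def using that P(4) by blast
  have partner_in: "(i, partner i) \<in> matching \<gamma>" if "i \<in> left_ends \<gamma>" for i
    using that partner by (fastforce simp: left_ends_def)
  define \<rho> where "\<rho> k = ?\<sigma> (Suc k) - 1" for k
  define \<tau> where "\<tau> k = ?\<sigma> (partner (Suc k)) - 1" for k
  define L where "L = {k. Suc k \<in> left_ends \<gamma>}"
  have Suc_\<rho>: "?\<sigma> (Suc k) = Suc (\<rho> k)" if "k < ?n" for k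
    using bound[of "Suc k"] that by (simp add: \<rho>_def)
  have L: "k < ?n" "\<rho> k < p" "k < partner (Suc k) - 1" "1 \<le> partner (Suc k)" "partner (Suc k) \<le> ?n"
    "p + m \<le> \<tau> k" "\<tau> k < ?n" "?\<sigma> (partner (Suc k)) = Suc (\<tau> k)"
    if "k \<in> L" for k
  proof -
    have left: "Suc k \<in> left_ends \<gamma>" using that by (simp add: L_def)
    then show kn: "k < ?n" using left_sub by fastforce
    show "\<rho> k < p" using bA[of "Suc k"] Suc_\<rho>[OF kn] left by (simp add: A_def)
    show "k < partner (Suc k) - 1" "1 \<le> partner (Suc k)" "partner (Suc k) \<le> ?n"
      using P(1-3)[OF partner_in[OF left]] by linarith+
    have "partner (Suc k) \<in> D"
      using partner_in[OF left] by (force simp: D_def right_ends_def)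
    then show "p + m \<le> \<tau> k" "\<tau> k < ?n" "?\<sigma> (partner (Suc k)) = Suc (\<tau> k)"
      using bD[of "partner (Suc k)"] by (auto simp: \<tau>_def)
  qed
  have link: "\<tau> k = \<rho> j \<longleftrightarrow> partner (Suc k) = Suc j" if "k \<in> L" "j < ?n" for k j
    using L(4,5,8)[OF that(1)] Suc_\<rho>[OF that(2)] inj[of "partner (Suc k)" "Suc j"] that(2) by auto
  have "clan_columns p m q ?n (preclan_mat p m q \<gamma>) \<rho> \<tau> L"
    unfolding clan_columns_def
  proof (intro conjI ballI allI impI)
    show "L \<subseteq> {..<?n}" using L(1) by auto
    show "inj_on \<rho> {..<?n}"
    proof (rule inj_onI)
      fix i j assume "i \<in> {..<?n}" "j \<in> {..<?n}" "\<rho> i = \<rho> j"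
      then show "i = j" using inj[of "Suc i" "Suc j"] Suc_\<rho>[of i] Suc_\<rho>[of j] by simp
    qed
    show "inj_on \<tau> L"
    proof (rule inj_onI)
      fix k l assume kl: "k \<in> L" "l \<in> L" "\<tau> k = \<tau> l"
      then have "partner (Suc k) = partner (Suc l)"
        using L(4,5,8)[OF kl(1)] L(4,5,8)[OF kl(2)] inj by simp
      then show "k = l"
        using P(5)[OF partner_in partner_in, of "Suc k" "Suc l"] kl by (simp add: L_def)
    qed
  next
    fix k assume "k < ?n"
    then show "\<rho> k < ?n" using Suc_\<rho>[of k] bound[of "Suc k"] by simp
  next
    fix k assume "k \<in> L"
    then show "\<rho> k < p" "p + m \<le> \<tau> k" "\<tau> k < ?n" using L by blast+
  next
    fix k j assume "k \<in> L" "j < ?n" "\<tau> k = \<rho> j"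
    then show "k < j" using link[of k j] L(3)[of k] by simp
  next
    fix k t assume k: "k < ?n" and t: "t < ?n"
    have "preclan_mat p m q \<gamma> $$ (t, k) = preclan_col p m q \<gamma> (Suc k) $ t"
      unfolding preclan_mat_def using k t by (simp add: mat_of_cols_index del: upt_Suc)
    also have "\<dots> = (if t = \<rho> k \<or> k \<in> L \<and> t = \<tau> k then 1 else 0)"
    proof (cases "k \<in> L")
      case True
      then have "preclan_col p m q \<gamma> (Suc k) = unit_vec ?n (\<rho> k) + unit_vec ?n (\<tau> k)"
        by (simp add: preclan_col_def Let_def std_basis_def L_def \<rho>_def \<tau>_def partner_def)
      then show ?thesis using True t L(2,6,7)[OF True] by auto
    next
      case False
      then have "preclan_col p m q \<gamma> (Suc k) = unit_vec ?n (\<rho> k)"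
        by (simp add: preclan_col_def Let_def std_basis_def L_def \<rho>_def)
      then show ?thesis using False t k Suc_\<rho>[OF k] bound[of "Suc k"] by auto
    qed
    finally show "preclan_mat p m q \<gamma> $$ (t, k) = (if t = \<rho> k \<or> k \<in> L \<and> t = \<tau> k then 1 else 0)" .
  qed
  moreover have "clan_of p m q \<rho> \<tau> L = \<gamma>"
  proof (rule preclan.equality)
    show "matching (clan_of p m q \<rho> \<tau> L) = matching \<gamma>"
    proof (rule Set.set_eqI, rule iffI)
      fix x assume "x \<in> matching (clan_of p m q \<rho> \<tau> L)"
      then obtain k j where "x = (Suc k, Suc j)" "k \<in> L" "j < ?n" "\<tau> k = \<rho> j"
        by (auto simp: clan_of_def)
      then show "x \<in> matching \<gamma>" using link[of k j] partner_in[of "Suc k"] by (simp add: L_def)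
    next
      fix x assume x: "x \<in> matching \<gamma>"
      obtain i j where ij: "x = (i, j)" by (cases x)
      then have b: "1 \<le> i" "i < j" "j \<le> ?n" using P(1-3) x by blast+
      then obtain k l where kl: "i = Suc k" "j = Suc l" by (metis Suc_le_D less_imp_le_nat order_trans One_nat_def)
      have "k \<in> L" using x ij kl by (force simp: L_def left_ends_def)
      moreover have "l < ?n" using b kl by simp
      moreover have "partner (Suc k) = Suc l" using partner x ij kl by simp
      ultimately show "x \<in> matching (clan_of p m q \<rho> \<tau> L)"
        using link[of k l] ij kl by (simp add: clan_of_def)
    qed
    have positive: "\<exists>k<?n. i = Suc k" if "i \<in> {1..?n}" for i
      using that by (intro exI[of _ "i - 1"]) auto
    have leftA: "plus_nodes \<gamma> = A - left_ends \<gamma>" using plus un by (auto simp: A_def)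
    have A\<rho>: "Suc k \<in> A \<longleftrightarrow> \<rho> k < p" if "k < ?n" for k
      using inA[of "Suc k"] Suc_\<rho>[OF that] that by auto
    show "plus_nodes (clan_of p m q \<rho> \<tau> L) = plus_nodes \<gamma>"
    proof (rule Set.set_eqI, rule iffI)
      fix i assume "i \<in> plus_nodes (clan_of p m q \<rho> \<tau> L)"
      then show "i \<in> plus_nodes \<gamma>" using A\<rho> leftA by (auto simp: clan_of_def L_def)
    next
      fix i assume i: "i \<in> plus_nodes \<gamma>"
      then have "i \<in> {1..?n}" using plus un by blast
      then obtain k where "k < ?n" "i = Suc k" using positive by blast
      then show "i \<in> plus_nodes (clan_of p m q \<rho> \<tau> L)"
        using i A\<rho>[of k] leftA by (auto simp: clan_of_def L_def)
    qed
    have rightD: "minus_nodes \<gamma> = D - right_ends \<gamma>" using minus un by (auto simp: D_def)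
    have D\<rho>: "Suc k \<in> D \<longleftrightarrow> p + m \<le> \<rho> k" if "k < ?n" for k
      using inD[of "Suc k"] Suc_\<rho>[OF that] that by auto
    have right\<tau>: "\<rho> j \<in> \<tau> ` L \<longleftrightarrow> Suc j \<in> right_ends \<gamma>" if j: "j < ?n" for j
    proof
      assume "\<rho> j \<in> \<tau> ` L"
      then obtain k where k: "k \<in> L" "\<tau> k = \<rho> j" by auto
      then have "(Suc k, Suc j) \<in> matching \<gamma>"
        using link[OF k(1) j] partner_in[of "Suc k"] by (simp add: L_def)
      then show "Suc j \<in> right_ends \<gamma>" by (force simp: right_ends_def)
    next
      assume "Suc j \<in> right_ends \<gamma>"
      then obtain i where i: "(i, Suc j) \<in> matching \<gamma>" by (auto simp: right_ends_def)
      then obtain k where k: "i = Suc k" using P(1) by (metis Suc_le_D One_nat_def)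
      have "k \<in> L" using i k by (force simp: L_def left_ends_def)
      then show "\<rho> j \<in> \<tau> ` L" using link[of k j] partner[OF i] k j by (metis imageI)
    qed
    show "minus_nodes (clan_of p m q \<rho> \<tau> L) = minus_nodes \<gamma>"
    proof (rule Set.set_eqI, rule iffI)
      fix i assume "i \<in> minus_nodes (clan_of p m q \<rho> \<tau> L)"
      then show "i \<in> minus_nodes \<gamma>" using D\<rho> rightD right\<tau> by (auto simp: clan_of_def)
    next
      fix i assume i: "i \<in> minus_nodes \<gamma>"
      then have "i \<in> {1..?n}" using minus un by blast
      then obtain k where "k < ?n" "i = Suc k" using positive by blast
      then show "i \<in> minus_nodes (clan_of p m q \<rho> \<tau> L)"
        using i D\<rho>[of k] rightD right\<tau>[of k] by (auto simp: clan_of_def)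
    qed
  qed simp
  ultimately show ?thesis by blast
qed

lemma preclan_mat_carrier: "preclan_mat p m q \<gamma> \<in> carrier_mat (p + m + q) (p + m + q)"
  by (rule carrier_matI) (simp_all add: preclan_mat_def del: upt_Suc)

section \<open>Classification of the double cosets\<close>

text \<open>Both matrices have the same shape up to the bijection of rows that sends \<open>\<rho> k\<close> to \<open>\<rho>' k\<close>. The
  preclan determines the block of \<open>\<rho> k\<close>, so the permutation matrix has the block shape; it sends
  \<open>\<tau> k\<close> to \<open>\<tau>' k\<close> because these are the leading rows of the partner of \<open>k\<close>.\<close>

lemma same_clan_imp_same_orbit:
  assumes C: "clan_columns p m q (p + m + q) M \<rho> \<tau> L" and M: "M \<in> carrier (GL (p + m + q))"
    and C': "clan_columns p m q (p + m + q) M' \<rho>' \<tau>' L'" and M': "M' \<in> carrier (GL (p + m + q))"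
    and eq: "clan_of p m q \<rho> \<tau> L = clan_of p m q \<rho>' \<tau>' L'"
  shows "same_orbit p m q M M'"
proof -
  let ?n = "p + m + q"
  note D = clan_columnsD[OF C] and D' = clan_columnsD[OF C']
  have Ln: "k < ?n" if "k \<in> L" for k using D(1) that by auto
  have L'n: "k < ?n" if "k \<in> L'" for k using D'(1) that by auto
  have matching: "k \<in> L \<and> j < ?n \<and> \<tau> k = \<rho> j \<longleftrightarrow> k \<in> L' \<and> j < ?n \<and> \<tau>' k = \<rho>' j" for k j
  proof -
    have "(Suc k, Suc j) \<in> matching (clan_of p m q \<rho> \<tau> L) \<longleftrightarrow>
        (Suc k, Suc j) \<in> matching (clan_of p m q \<rho>' \<tau>' L')" unfolding eq ..
    then show ?thesis by (simp add: clan_of_def)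
  qed
  have LL: "L = L'"
    using matching clan_columns_row[OF C D(6)] clan_columns_row[OF C' D'(6)] by (metis subsetI subset_antisym)
  have right: "\<rho> j \<in> \<tau> ` L \<longleftrightarrow> \<rho>' j \<in> \<tau>' ` L'" if "j < ?n" for j
    using matching[of _ j] that by (auto simp: image_iff) metis+
  have "k \<notin> L \<and> \<rho> k < p \<longleftrightarrow> k \<notin> L' \<and> \<rho>' k < p" if "k < ?n" for k
  proof -
    have "Suc k \<in> plus_nodes (clan_of p m q \<rho> \<tau> L) \<longleftrightarrow>
        Suc k \<in> plus_nodes (clan_of p m q \<rho>' \<tau>' L')" unfolding eq ..
    then show ?thesis using that by (simp add: clan_of_def image_iff)
  qed
  then have top: "\<rho> k < p \<longleftrightarrow> \<rho>' k < p" if "k < ?n" for k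
    using that D(4)[of k] D'(4)[of k] LL by (cases "k \<in> L") auto
  have "p + m \<le> \<rho> k \<and> \<rho> k \<notin> \<tau> ` L \<longleftrightarrow> p + m \<le> \<rho>' k \<and> \<rho>' k \<notin> \<tau>' ` L'" if "k < ?n" for k
  proof -
    have "Suc k \<in> minus_nodes (clan_of p m q \<rho> \<tau> L) \<longleftrightarrow>
        Suc k \<in> minus_nodes (clan_of p m q \<rho>' \<tau>' L')" unfolding eq ..
    then show ?thesis using that by (simp add: clan_of_def image_iff)
  qed
  then have bottom: "p + m \<le> \<rho> k \<longleftrightarrow> p + m \<le> \<rho>' k" if "k < ?n" for k
    using that right[OF that] D(5) D'(5) by (metis imageE)
  define P where "P = mat ?n ?n (\<lambda>(t, r). if \<exists>k<?n. r = \<rho> k \<and> t = \<rho>' k then 1 else 0 :: complex)"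
  have Pc: "P \<in> carrier_mat ?n ?n" by (simp add: P_def)
  have Mc: "M \<in> carrier_mat ?n ?n" "M' \<in> carrier_mat ?n ?n" using M M' by (auto simp: GL_iff)
  have "P * M = M'"
  proof (rule eq_matI)
    fix t k assume "t < dim_row M'" "k < dim_col M'"
    then have t: "t < ?n" and k: "k < ?n" using Mc by auto
    obtain i where i: "i < ?n" "t = \<rho>' i" using clan_columns_row[OF C' t] .
    have P_entry: "P $$ (t, \<rho> j) = (if j = i then 1 else 0)" if j: "j < ?n" for j
    proof -
      have "(\<exists>l<?n. \<rho> j = \<rho> l \<and> t = \<rho>' l) \<longleftrightarrow> j = i"
        using i j D(2) D'(2) by (auto simp: inj_on_def)
      then show ?thesis using t D(3)[OF j] by (simp add: P_def)
    qed
    have "(P * M) $$ (t, k) = (\<Sum>r<?n. P $$ (t, r) * M $$ (r, k))"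
      by (rule mult_mat_entry[OF Pc Mc(1) t k])
    also have "\<dots> = (\<Sum>j<?n. P $$ (t, \<rho> j) * M $$ (\<rho> j, k))"
      by (rule sum.reindex_bij_betw[OF clan_columns_bij[OF C], symmetric])
    also have "\<dots> = (\<Sum>j<?n. if j = i then M $$ (\<rho> j, k) else 0)"
      by (rule sum.cong) (use P_entry in auto)
    also have "\<dots> = M $$ (\<rho> i, k)" using i by simp
    also have "\<dots> = M' $$ (t, k)"
    proof -
      have "\<rho> i = \<rho> k \<longleftrightarrow> \<rho>' i = \<rho>' k"
        using inj_on_eq_iff[OF D(2), of i k] inj_on_eq_iff[OF D'(2), of i k] i k by auto
      moreover have "k \<in> L \<and> \<rho> i = \<tau> k \<longleftrightarrow> k \<in> L' \<and> \<rho>' i = \<tau>' k"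
        using matching[of k i] i by metis
      ultimately show ?thesis using D(9)[OF k D(3)[OF i(1)]] D'(9)[OF k t] i(2) by simp
    qed
    finally show "(P * M) $$ (t, k) = M' $$ (t, k)" .
  qed (use Pc Mc in auto)
  then have "det P \<noteq> 0" using M' det_mult[OF Pc Mc(1)] by (auto simp: GL_iff)
  then have PG: "P \<in> carrier (GL ?n)" using Pc by (simp add: GL_iff)
  have "P $$ (t, r) = 0" if "t < ?n" "r < ?n" "\<not> admissible p m t r" for t r
    using that top bottom unfolding P_def by (auto simp: admissible_def not_le[symmetric])
  then have "P \<in> block_subgroup p m q" using PG by (simp add: block_subgroup_iff)
  moreover have "M' = P * M * 1\<^sub>m ?n" using \<open>P * M = M'\<close> Mc by simp
  ultimately show ?thesis
    unfolding same_orbit_def using subgroup.one_closed[OF subgroup_upper_tri, of ?n] by auto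
qed

lemma preclan_mat_GL:
  assumes "\<gamma> \<in> preclans p m q"
  shows "preclan_mat p m q \<gamma> \<in> carrier (GL (p + m + q))"
  using preclan_mat_clan_columns[OF assms] clan_columns_GL[OF _ preclan_mat_carrier] by blast

lemma same_orbit_preclan_mat_ex:
  assumes g: "g \<in> carrier (GL (p + m + q))"
  shows "\<exists>\<gamma> \<in> preclans p m q. same_orbit p m q (preclan_mat p m q \<gamma>) g"
proof -
  obtain M \<rho> \<tau> L where M: "M \<in> carrier (GL (p + m + q))" "same_orbit p m q g M"
    and C: "clan_columns p m q (p + m + q) M \<rho> \<tau> L"
    using reduce_to_clan_columns[OF g] by blast
  let ?\<gamma> = "clan_of p m q \<rho> \<tau> L"
  have \<gamma>: "?\<gamma> \<in> preclans p m q" using clan_of_in_preclans[OF C] .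
  obtain \<rho>' \<tau>' L' where C': "clan_columns p m q (p + m + q) (preclan_mat p m q ?\<gamma>) \<rho>' \<tau>' L'"
    and eq: "clan_of p m q \<rho>' \<tau>' L' = ?\<gamma>"
    using preclan_mat_clan_columns[OF \<gamma>] by blast
  have "same_orbit p m q (preclan_mat p m q ?\<gamma>) M"
    using same_clan_imp_same_orbit[OF C' preclan_mat_GL[OF \<gamma>] C M(1) eq] .
  then have "same_orbit p m q (preclan_mat p m q ?\<gamma>) g"
    using same_orbit_trans[OF preclan_mat_GL[OF \<gamma>]] same_orbit_sym[OF g M(2)] by blast
  then show ?thesis using \<gamma> by blast
qed

lemma flag_clan_preclan_mat:
  assumes "\<gamma> \<in> preclans p m q"
  shows "flag_clan p m q (preclan_mat p m q \<gamma>) = \<gamma>"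
  using preclan_mat_clan_columns[OF assms] flag_clan_eq_clan_of[OF _ preclan_mat_carrier] by metis

lemma same_orbit_preclan_mat_unique:
  assumes "\<gamma> \<in> preclans p m q" "\<gamma>' \<in> preclans p m q"
    and "same_orbit p m q (preclan_mat p m q \<gamma>) (preclan_mat p m q \<gamma>')"
  shows "\<gamma> = \<gamma>'"
  using flag_clan_invariant[OF assms(3)] assms(1,2) preclan_mat_GL flag_clan_preclan_mat by metis

lemma finite_preclans: "finite (preclans p m q)"
proof -
  let ?n = "p + m + q"
  let ?f = "\<lambda>(M, A, B). \<lparr>matching = M, plus_nodes = A, minus_nodes = B\<rparr>"
  have "preclans p m q \<subseteq> ?f ` (Pow ({..?n} \<times> {..?n}) \<times> Pow {..?n} \<times> Pow {..?n})"
  proof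
    fix \<gamma> :: preclan assume \<gamma>: "\<gamma> \<in> preclans p m q"
    then have pm: "partial_matching ?n (matching \<gamma>)" by (simp add: preclans_def Let_def)
    have "matching \<gamma> \<subseteq> {..?n} \<times> {..?n}" using partial_matchingD[OF pm] by fastforce
    moreover have "plus_nodes \<gamma> \<subseteq> {..?n}" "minus_nodes \<gamma> \<subseteq> {..?n}"
      using \<gamma> by (auto simp: preclans_def Let_def unmatched_nodes_def)
    ultimately show "\<gamma> \<in> ?f ` (Pow ({..?n} \<times> {..?n}) \<times> Pow {..?n} \<times> Pow {..?n})"
      by (intro image_eqI[of _ _ "(matching \<gamma>, plus_nodes \<gamma>, minus_nodes \<gamma>)"]) auto
  qed
  then show ?thesis by (rule finite_subset) simp
qed

section \<open>Orbits on the flag variety\<close>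

lemma orbit_flag_eq:
  assumes g: "g \<in> carrier (GL (p + m + q))"
  shows "orbit (block_group p m q) (left_mult (p + m + q))
       (g <#\<^bsub>GL (p + m + q)\<^esub> upper_tri_subgroup (p + m + q))
    = {h <#\<^bsub>GL (p + m + q)\<^esub> upper_tri_subgroup (p + m + q) | h.
         h \<in> carrier (GL (p + m + q)) \<and> same_orbit p m q g h}"
proof -
  let ?n = "p + m + q"
  let ?G = "GL ?n" and ?B = "upper_tri_subgroup ?n"
  interpret group ?G by (rule group_GL)
  have B: "subgroup ?B ?G" by (rule subgroup_upper_tri)
  have Bsub: "?B \<subseteq> carrier ?G" using subgroup.subset[OF B] .
  have gB: "g <#\<^bsub>?G\<^esub> ?B \<in> flag_variety ?n" using g by (auto simp: flag_variety_def LCOSETS_def)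
  have SG: "s \<in> carrier ?G" if "s \<in> block_subgroup p m q" for s
    using that by (simp add: block_subgroup_iff)
  have coset: "s <#\<^bsub>?G\<^esub> (g <#\<^bsub>?G\<^esub> ?B) = (s * g) <#\<^bsub>?G\<^esub> ?B" if "s \<in> block_subgroup p m q" for s
    using lcos_m_assoc[OF Bsub SG[OF that] g] by simp
  have "orbit (block_group p m q) (left_mult ?n) (g <#\<^bsub>?G\<^esub> ?B)
      = {(s * g) <#\<^bsub>?G\<^esub> ?B | s. s \<in> block_subgroup p m q}"
    using gB coset unfolding orbit_def block_group_def left_mult_def by auto
  also have "\<dots> = {h <#\<^bsub>?G\<^esub> ?B | h. h \<in> carrier ?G \<and> same_orbit p m q g h}"
  proof (intro Collect_cong iffI; elim exE conjE)
    fix X s assume X: "X = (s * g) <#\<^bsub>?G\<^esub> ?B" and s: "s \<in> block_subgroup p m q"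
    have sg: "s * g \<in> carrier ?G" using GL_mult[OF SG[OF s] g] .
    have "s * g \<in> carrier_mat ?n ?n" using sg unfolding GL_iff ..
    then have "s * g = s * g * 1\<^sub>m ?n" by (rule right_mult_one_mat[symmetric])
    then have "same_orbit p m q g (s * g)"
      unfolding same_orbit_def using s subgroup.one_closed[OF B] by auto
    then show "\<exists>h. X = h <#\<^bsub>?G\<^esub> ?B \<and> h \<in> carrier ?G \<and> same_orbit p m q g h" using X sg by blast
  next
    fix X h assume X: "X = h <#\<^bsub>?G\<^esub> ?B" and h: "h \<in> carrier ?G" and same: "same_orbit p m q g h"
    obtain s b where s: "s \<in> block_subgroup p m q" and b: "b \<in> ?B" and eq: "h = s * g * b"
      using same unfolding same_orbit_def by blast
    have "h \<in> (s * g) <#\<^bsub>?G\<^esub> ?B" unfolding l_coset_def using b eq by auto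
    then have "(s * g) <#\<^bsub>?G\<^esub> ?B = h <#\<^bsub>?G\<^esub> ?B"
      using l_repr_independence[OF _ GL_mult[OF SG[OF s] g] B] by blast
    then show "\<exists>s. X = (s * g) <#\<^bsub>?G\<^esub> ?B \<and> s \<in> block_subgroup p m q" using X s by metis
  qed
  finally show ?thesis .
qed

lemma same_orbit_coset:
  assumes "g \<in> carrier (GL (p + m + q))" "h \<in> carrier (GL (p + m + q))" "h' \<in> carrier (GL (p + m + q))"
    and eq: "h <#\<^bsub>GL (p + m + q)\<^esub> upper_tri_subgroup (p + m + q)
        = h' <#\<^bsub>GL (p + m + q)\<^esub> upper_tri_subgroup (p + m + q)"
    and same: "same_orbit p m q g h"
  shows "same_orbit p m q g h'"
proof -
  let ?n = "p + m + q"
  interpret group "GL ?n" by (rule group_GL)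
  have "h' \<in> h <#\<^bsub>GL ?n\<^esub> upper_tri_subgroup ?n"
    using lcos_self[OF assms(3) subgroup_upper_tri] eq by simp
  then obtain b where b: "b \<in> upper_tri_subgroup ?n" "h' = h * b" by (auto simp: l_coset_def)
  have "h \<in> carrier_mat ?n ?n" using assms(2) unfolding GL_iff ..
  then have "1\<^sub>m ?n * h = h" by simp
  then have "same_orbit p m q h h'"
    unfolding same_orbit_def using b subgroup.one_closed[OF subgroup_block, of p m q]
    by (metis GL_simps(2))
  then show ?thesis using same_orbit_trans[OF assms(1) same] by blast
qed

theorem theorem3p3:
  fixes p m q :: nat
  shows "finite (flag_orbits p m q)
    \<and> bij_betw (preclan_orbit p m q) (preclans p m q) (flag_orbits p m q)
    \<and> flag_variety (p + m + q) = (\<Union>\<gamma> \<in> preclans p m q. preclan_orbit p m q \<gamma>)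
    \<and> disjoint_family_on (preclan_orbit p m q) (preclans p m q)"
proof -
  let ?n = "p + m + q"
  let ?G = "GL ?n" and ?B = "upper_tri_subgroup ?n"
  let ?orb = "\<lambda>g. orbit (block_group p m q) (left_mult ?n) (g <#\<^bsub>?G\<^esub> ?B)"
  let ?mat = "preclan_mat p m q"
  note GL = preclan_mat_GL
  have pre: "preclan_orbit p m q \<gamma> = ?orb (?mat \<gamma>)" for \<gamma>
    by (simp add: preclan_orbit_def)
  have flags: "flag_variety ?n = {g <#\<^bsub>?G\<^esub> ?B | g. g \<in> carrier ?G}"
    by (auto simp: flag_variety_def LCOSETS_def)
  have orbits: "flag_orbits p m q = {?orb g | g. g \<in> carrier ?G}"
    unfolding flag_orbits_def orbits_def flags by blast
  have mem: "h <#\<^bsub>?G\<^esub> ?B \<in> ?orb g \<longleftrightarrow> same_orbit p m q g h"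
    if "g \<in> carrier ?G" "h \<in> carrier ?G" for g h
    unfolding orbit_flag_eq[OF that(1)] using that same_orbit_coset[OF that(1) _ that(2)] by fastforce
  have disjoint: "preclan_orbit p m q \<gamma> \<inter> preclan_orbit p m q \<gamma>' = {}"
    if \<gamma>: "\<gamma> \<in> preclans p m q" "\<gamma>' \<in> preclans p m q" "\<gamma> \<noteq> \<gamma>'" for \<gamma> \<gamma>'
  proof (rule ccontr)
    assume "\<not> ?thesis"
    then obtain h where h: "h \<in> carrier ?G" "same_orbit p m q (?mat \<gamma>) h"
      "h <#\<^bsub>?G\<^esub> ?B \<in> ?orb (?mat \<gamma>')"
      unfolding pre orbit_flag_eq[OF GL[OF \<gamma>(1)]] by blast
    then have "same_orbit p m q (?mat \<gamma>') h" using mem[OF GL[OF \<gamma>(2)] h(1)] by blast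
    then have "same_orbit p m q (?mat \<gamma>) (?mat \<gamma>')"
      using same_orbit_trans[OF GL[OF \<gamma>(1)] h(2)] same_orbit_sym[OF GL[OF \<gamma>(2)]] by blast
    then show False using same_orbit_preclan_mat_unique[OF \<gamma>(1,2)] \<gamma>(3) by blast
  qed
  have nonempty: "preclan_orbit p m q \<gamma> \<noteq> {}" if "\<gamma> \<in> preclans p m q" for \<gamma>
    using mem[OF GL[OF that] GL[OF that]] same_orbit_refl[OF GL[OF that]] unfolding pre by blast
  have covering: "\<exists>\<gamma> \<in> preclans p m q. ?orb g = preclan_orbit p m q \<gamma>" if g: "g \<in> carrier ?G" for g
  proof -
    obtain \<gamma> where \<gamma>: "\<gamma> \<in> preclans p m q" and same: "same_orbit p m q (?mat \<gamma>) g"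
      using same_orbit_preclan_mat_ex[OF g] by blast
    have "same_orbit p m q g h \<longleftrightarrow> same_orbit p m q (?mat \<gamma>) h" for h
      using same_orbit_trans[OF GL[OF \<gamma>] same] same_orbit_trans[OF g same_orbit_sym[OF GL[OF \<gamma>] same]]
      by blast
    then have "?orb g = preclan_orbit p m q \<gamma>"
      unfolding pre orbit_flag_eq[OF g] orbit_flag_eq[OF GL[OF \<gamma>]] by simp
    then show ?thesis using \<gamma> by blast
  qed
  have image: "preclan_orbit p m q ` preclans p m q = flag_orbits p m q"
    unfolding orbits using covering GL pre by blast
  have "inj_on (preclan_orbit p m q) (preclans p m q)"
    using disjoint nonempty by (metis inf.idem inj_onI)
  then have bij: "bij_betw (preclan_orbit p m q) (preclans p m q) (flag_orbits p m q)"
    using image by (simp add: bij_betw_def)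
  have "flag_variety ?n = (\<Union>\<gamma> \<in> preclans p m q. preclan_orbit p m q \<gamma>)"
  proof (intro subset_antisym subsetI)
    fix X assume "X \<in> flag_variety ?n"
    then obtain g where g: "g \<in> carrier ?G" "X = g <#\<^bsub>?G\<^esub> ?B" unfolding flags by blast
    then have "X \<in> ?orb g" using mem[OF g(1) g(1)] same_orbit_refl[OF g(1)] by simp
    then show "X \<in> (\<Union>\<gamma> \<in> preclans p m q. preclan_orbit p m q \<gamma>)" using covering[OF g(1)] by blast
  next
    fix X assume "X \<in> (\<Union>\<gamma> \<in> preclans p m q. preclan_orbit p m q \<gamma>)"
    then obtain \<gamma> where \<gamma>: "\<gamma> \<in> preclans p m q" "X \<in> ?orb (?mat \<gamma>)" unfolding pre by blast
    then show "X \<in> flag_variety ?n" unfolding orbit_flag_eq[OF GL[OF \<gamma>(1)]] flags by blast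
  qed
  moreover have "disjoint_family_on (preclan_orbit p m q) (preclans p m q)"
    unfolding disjoint_family_on_def using disjoint by blast
  moreover have "finite (flag_orbits p m q)" using image finite_preclans by (metis finite_imageI)
  ultimately show ?thesis using bij by blast
qed

end
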